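(* Let $(\Sigma,\omega)$ be an oriented signed graph and let $f$ be an integral flow on $(\Sigma,\omega)$. Then $f$ is conformally indecomposable if and only if the support subgraph $\Sigma(f)$ is a sesqui-Eulerian circle-tree and there is a direction of $\Sigma(f)$, denoted $\omega_f$, such that \[ f=[\omega,\omega_f]\, I_{\Sigma(f)} . \]
   Context: All graphs are finite; loops and multiple edges are allowed. A signed graph $\Sigma$ is a graph with a sign function $\sigma:E(\Sigma)\to\{+1,-1\}$. Each edge $e$ has two ends (incidences) $(u,e),(v,e)$, where $u,v$ are its endpoints; a loop has two distinct ends at the same vertex. A circle is a connected 2-regular subgraph; its sign is the product of the signs of its edges. An orientation $\omega$ of $\Sigma$ assigns to each edge end $(v,e)$ a value $\omega(v,e)\in\{+1,-1\}$ such that $\sigma(e)=-\omega(u,e)\omega(v,e)$ for every edge $e$ with ends $(u,e),(v,e)$. A sink (resp. source) is a vertex $v$ with $\omega(v,e)=+1$ (resp. $-1$) for all ends $(v,e)$ at $v$. For two orientations $\omega_1,\omega_2$ defined on subgraphs, the coupling is $[\omega_1,\omega_2](e)=\omega_1(v,e)\omega_2(v,e)$ (for either end $(v,e)$) if $e$ lies in both subgraphs, and $0$ otherwise. The boundary of $g:E(\Sigma)\to\mathbb Z$ is $\partial g(v)=\sum_{(v,e)}\omega(v,e)g(e)$, the sum over all edge ends at $v$ (a loop contributes for both of its ends). An integral flow is $f:E(\Sigma)\to\mathbb Z$ with $\partial f\equiv 0$. $\Sigma(f)$ is the subgraph consisting of the edges $e$ with $f(e)\neq 0$ and their endpoints.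 A flow $f$ is conformally decomposable if it is nonzero and $f=f_1+f_2$ with $f_1,f_2$ nonzero integral flows satisfying $f_1(e)f_2(e)\ge 0$ for all edges $e$; it is conformally indecomposable if it is nonzero and not conformally decomposable. A block of a graph is a maximal connected subgraph without cut-vertices, where a cut-vertex is a vertex whose deletion increases the number of components, or a vertex incident with a loop and at least one other edge (so loops, cut-edges and isolated vertices are blocks). An end block is a block that shares a vertex with exactly one other block. A circle-tree is a signed graph $T$ with nonempty edge set such that: (a) $T$ is connected; (b) each block is a circle or a single edge; (c) each end block is a circle; (d) each cut-vertex is incident with exactly two blocks. Blocks that are circles are circle blocks; the block paths are the paths (possibly of length zero) connecting pairs of circle blocks through non-circle blocks (a block path of length $0$ is a common vertex of two circle blocks). $T$ is a sesqui-Eulerian circle-tree if moreover every circle block has sign $(-1)^p$, where $p$ is the number of cut-vertices of $T$ on that circle. A direction of a sesqui-Eulerian circle-tree $T$ is an orientation $\omega_T$ of $T$ such that $(T,\omega_T)$ has no sink and no source, and for each circle block $C$, the oriented circle $(C,\omega_T)$ has a sink or a source at each cut-vertex of $T$ lying on $C$. For a circle-tree $T$ in $\Sigma$, the indicator $I_T:E(\Sigma)\to\mathbb Z$ is $1$ on edges of circle blocks, $2$ on edges of block paths, and $0$ elsewhere. *)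

theory Defs
  imports Main
begin

text \<open>
  The two ends of an edge \<open>e\<close> are the pairs \<open>(e, False)\<close> and \<open>(e, True)\<close>, and \<open>endv G e b\<close> is the
  vertex at which the end \<open>(e, b)\<close> is attached. Thus loops have two distinct ends at the same vertex
  and parallel edges are allowed. The labelling of the two ends carries no direction.
\<close>

record ('v, 'e) sgraph =
  verts :: "'v set"
  edges :: "'e set"
  endv :: "'e \<Rightarrow> bool \<Rightarrow> 'v"
  esign :: "'e \<Rightarrow> int"

definition signed_graph :: "('v, 'e) sgraph \<Rightarrow> bool" where
  "signed_graph G \<longleftrightarrow> finite (verts G) \<and> finite (edges G) \<and>
     (\<forall>e\<in>edges G. (\<forall>b. endv G e b \<in> verts G) \<and> esign G e \<in> {1, -1})"

definition ends_at :: "('v, 'e) sgraph \<Rightarrow> 'v \<Rightarrow> ('e \<times> bool) set" where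
  "ends_at G v = {(e, b). e \<in> edges G \<and> endv G e b = v}"

definition degree :: "('v, 'e) sgraph \<Rightarrow> 'v \<Rightarrow> nat" where
  "degree G v = card (ends_at G v)"

text \<open>
  A subgraph keeps the incidence and sign functions of the ambient graph as total functions, so that
  it is determined by its vertex and edge sets and equality of subgraphs is equality of records.
\<close>

definition subgraph :: "('v, 'e) sgraph \<Rightarrow> ('v, 'e) sgraph \<Rightarrow> bool" where
  "subgraph H G \<longleftrightarrow> signed_graph H \<and> verts H \<subseteq> verts G \<and> edges H \<subseteq> edges G \<and>
     endv H = endv G \<and> esign H = esign G"

definition delete_vertex :: "('v, 'e) sgraph \<Rightarrow> 'v \<Rightarrow> ('v, 'e) sgraph" where
  "delete_vertex G v =
     G\<lparr>verts := verts G - {v}, edges := {e \<in> edges G. \<forall>b. endv G e b \<noteq> v}\<rparr>"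

definition adjacency :: "('v, 'e) sgraph \<Rightarrow> ('v \<times> 'v) set" where
  "adjacency G = {(endv G e b, endv G e (\<not> b)) | e b. e \<in> edges G}"

definition joined :: "('v, 'e) sgraph \<Rightarrow> ('v \<times> 'v) set" where
  "joined G = {(u, v). u \<in> verts G \<and> v \<in> verts G \<and> (u, v) \<in> (adjacency G)\<^sup>*}"

definition components :: "('v, 'e) sgraph \<Rightarrow> 'v set set" where
  "components G = verts G // joined G"

text \<open>The graph without vertices is not connected.\<close>

definition connected_graph :: "('v, 'e) sgraph \<Rightarrow> bool" where
  "connected_graph G \<longleftrightarrow> card (components G) = 1"

definition circle :: "('v, 'e) sgraph \<Rightarrow> bool" where
  "circle C \<longleftrightarrow> connected_graph C \<and> (\<forall>v\<in>verts C. degree C v = 2)"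

definition circle_sign :: "('v, 'e) sgraph \<Rightarrow> int" where
  "circle_sign C = (\<Prod>e\<in>edges C. esign C e)"

definition cut_vertex :: "('v, 'e) sgraph \<Rightarrow> 'v \<Rightarrow> bool" where
  "cut_vertex G v \<longleftrightarrow> v \<in> verts G \<and>
     (card (components (delete_vertex G v)) > card (components G) \<or>
      (\<exists>e\<in>edges G. (\<forall>b. endv G e b = v) \<and> (\<exists>e'\<in>edges G. e' \<noteq> e \<and> (\<exists>b. endv G e' b = v))))"

definition connected_without_cut_vertices :: "('v, 'e) sgraph \<Rightarrow> bool" where
  "connected_without_cut_vertices B \<longleftrightarrow> connected_graph B \<and> (\<forall>v. \<not> cut_vertex B v)"

definition block :: "('v, 'e) sgraph \<Rightarrow> ('v, 'e) sgraph \<Rightarrow> bool" where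
  "block G B \<longleftrightarrow> subgraph B G \<and> connected_without_cut_vertices B \<and>
     (\<forall>B'. subgraph B' G \<longrightarrow> connected_without_cut_vertices B' \<longrightarrow> subgraph B B' \<longrightarrow> B' = B)"

definition end_block :: "('v, 'e) sgraph \<Rightarrow> ('v, 'e) sgraph \<Rightarrow> bool" where
  "end_block G B \<longleftrightarrow> block G B \<and> (\<exists>!B'. block G B' \<and> B' \<noteq> B \<and> verts B' \<inter> verts B \<noteq> {})"

definition circle_block :: "('v, 'e) sgraph \<Rightarrow> ('v, 'e) sgraph \<Rightarrow> bool" where
  "circle_block G C \<longleftrightarrow> block G C \<and> circle C"

definition single_edge :: "('v, 'e) sgraph \<Rightarrow> bool" where
  "single_edge B \<longleftrightarrow> (\<exists>e. edges B = {e} \<and> verts B = range (endv B e))"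

definition circle_tree :: "('v, 'e) sgraph \<Rightarrow> bool" where
  "circle_tree T \<longleftrightarrow> signed_graph T \<and> edges T \<noteq> {} \<and>
     connected_graph T \<and>
     (\<forall>B. block T B \<longrightarrow> circle B \<or> single_edge B) \<and>
     (\<forall>B. end_block T B \<longrightarrow> circle B) \<and>
     (\<forall>v. cut_vertex T v \<longrightarrow> card {B. block T B \<and> v \<in> verts B} = 2)"

definition path :: "('v, 'e) sgraph \<Rightarrow> 'v list \<Rightarrow> 'e list \<Rightarrow> bool" where
  "path G vs es \<longleftrightarrow> length vs = Suc (length es) \<and> distinct vs \<and>
     set vs \<subseteq> verts G \<and> set es \<subseteq> edges G \<and>
     (\<forall>i<length es. range (endv G (es ! i)) = {vs ! i, vs ! Suc i})"

text \<open>A block path of length zero is \<open>block_path T [v] []\<close>, where \<open>v\<close> is on two circle blocks.\<close>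

definition block_path :: "('v, 'e) sgraph \<Rightarrow> 'v list \<Rightarrow> 'e list \<Rightarrow> bool" where
  "block_path T vs es \<longleftrightarrow> path T vs es \<and>
     (\<exists>C C'. circle_block T C \<and> circle_block T C' \<and> C \<noteq> C' \<and>
        hd vs \<in> verts C \<and> last vs \<in> verts C') \<and>
     (\<forall>e\<in>set es. \<exists>B. block T B \<and> \<not> circle B \<and> e \<in> edges B)"

definition sesqui_eulerian_circle_tree :: "('v, 'e) sgraph \<Rightarrow> bool" where
  "sesqui_eulerian_circle_tree T \<longleftrightarrow> circle_tree T \<and>
     (\<forall>C. circle_block T C \<longrightarrow>
        circle_sign C = (-1) ^ card {v \<in> verts C. cut_vertex T v})"

definition tree_indicator :: "('v, 'e) sgraph \<Rightarrow> 'e \<Rightarrow> int" where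
  "tree_indicator T e =
     (if \<exists>C. circle_block T C \<and> e \<in> edges C then 1
      else if \<exists>vs es. block_path T vs es \<and> e \<in> set es then 2
      else 0)"

text \<open>
  The value of an orientation on the end \<open>(e, b)\<close> is \<open>\<omega> e b\<close>; only values on edges of the graph matter.
\<close>

definition orientation :: "('v, 'e) sgraph \<Rightarrow> ('e \<Rightarrow> bool \<Rightarrow> int) \<Rightarrow> bool" where
  "orientation G \<omega> \<longleftrightarrow>
     (\<forall>e\<in>edges G. (\<forall>b. \<omega> e b \<in> {1, -1}) \<and> esign G e = - (\<omega> e False * \<omega> e True))"

definition sink :: "('v, 'e) sgraph \<Rightarrow> ('e \<Rightarrow> bool \<Rightarrow> int) \<Rightarrow> 'v \<Rightarrow> bool" where
  "sink G \<omega> v \<longleftrightarrow> v \<in> verts G \<and> (\<forall>(e, b)\<in>ends_at G v. \<omega> e b = 1)"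

definition source :: "('v, 'e) sgraph \<Rightarrow> ('e \<Rightarrow> bool \<Rightarrow> int) \<Rightarrow> 'v \<Rightarrow> bool" where
  "source G \<omega> v \<longleftrightarrow> v \<in> verts G \<and> (\<forall>(e, b)\<in>ends_at G v. \<omega> e b = -1)"

definition direction :: "('v, 'e) sgraph \<Rightarrow> ('e \<Rightarrow> bool \<Rightarrow> int) \<Rightarrow> bool" where
  "direction T \<omega> \<longleftrightarrow> orientation T \<omega> \<and>
     (\<forall>v. \<not> sink T \<omega> v \<and> \<not> source T \<omega> v) \<and>
     (\<forall>C v. circle_block T C \<longrightarrow> v \<in> verts C \<longrightarrow> cut_vertex T v \<longrightarrow> sink C \<omega> v \<or> source C \<omega> v)"

text \<open>
  \<open>coupling H1 \<omega>1 H2 \<omega>2\<close> is the coupling of orientations \<open>\<omega>1\<close>, \<open>\<omega>2\<close> of subgraphs \<open>H1\<close>, \<open>H2\<close> of a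
  common signed graph. It is computed at the end \<open>(e, False)\<close>; the other end gives the same value.
\<close>

definition coupling :: "('v, 'e) sgraph \<Rightarrow> ('e \<Rightarrow> bool \<Rightarrow> int) \<Rightarrow>
    ('v, 'e) sgraph \<Rightarrow> ('e \<Rightarrow> bool \<Rightarrow> int) \<Rightarrow> 'e \<Rightarrow> int" where
  "coupling H1 \<omega>1 H2 \<omega>2 e =
     (if e \<in> edges H1 \<inter> edges H2 then \<omega>1 e False * \<omega>2 e False else 0)"

lemma coupling_either_end:
  assumes "orientation H1 \<omega>1" "orientation H2 \<omega>2" "esign H1 = esign H2"
    and "e \<in> edges H1" "e \<in> edges H2"
  shows "coupling H1 \<omega>1 H2 \<omega>2 e = \<omega>1 e b * \<omega>2 e b"
proof -
  have *: "\<omega>1 e c = 1 \<or> \<omega>1 e c = -1" "\<omega>2 e c = 1 \<or> \<omega>2 e c = -1" for c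
    using assms unfolding orientation_def by auto
  have "\<omega>1 e False * \<omega>1 e True = \<omega>2 e False * \<omega>2 e True"
    using assms unfolding orientation_def by auto
  then have "\<omega>1 e False * \<omega>2 e False = \<omega>1 e True * \<omega>2 e True"
    using *[of False] *[of True] by auto
  then show ?thesis
    using assms(4,5) by (cases b) (auto simp: coupling_def)
qed

definition boundary ::
    "('v, 'e) sgraph \<Rightarrow> ('e \<Rightarrow> bool \<Rightarrow> int) \<Rightarrow> ('e \<Rightarrow> int) \<Rightarrow> 'v \<Rightarrow> int" where
  "boundary G \<omega> g v = (\<Sum>(e, b)\<in>ends_at G v. \<omega> e b * g e)"

text \<open>
  Functions on the edge set are total functions on \<open>'e\<close> whose values outside \<open>edges G\<close> are ignored.
\<close>

definition integral_flow ::
    "('v, 'e) sgraph \<Rightarrow> ('e \<Rightarrow> bool \<Rightarrow> int) \<Rightarrow> ('e \<Rightarrow> int) \<Rightarrow> bool" where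
  "integral_flow G \<omega> f \<longleftrightarrow> (\<forall>v\<in>verts G. boundary G \<omega> f v = 0)"

definition nonzero_on_edges :: "('v, 'e) sgraph \<Rightarrow> ('e \<Rightarrow> int) \<Rightarrow> bool" where
  "nonzero_on_edges G f \<longleftrightarrow> (\<exists>e\<in>edges G. f e \<noteq> 0)"

definition support :: "('v, 'e) sgraph \<Rightarrow> ('e \<Rightarrow> int) \<Rightarrow> ('v, 'e) sgraph" where
  "support G f =
     G\<lparr>verts := {endv G e b | e b. e \<in> edges G \<and> f e \<noteq> 0}, edges := {e \<in> edges G. f e \<noteq> 0}\<rparr>"

definition conformally_decomposable ::
    "('v, 'e) sgraph \<Rightarrow> ('e \<Rightarrow> bool \<Rightarrow> int) \<Rightarrow> ('e \<Rightarrow> int) \<Rightarrow> bool" where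
  "conformally_decomposable G \<omega> f \<longleftrightarrow> nonzero_on_edges G f \<and>
     (\<exists>f1 f2. integral_flow G \<omega> f1 \<and> integral_flow G \<omega> f2 \<and>
        nonzero_on_edges G f1 \<and> nonzero_on_edges G f2 \<and>
        (\<forall>e\<in>edges G. f e = f1 e + f2 e) \<and> (\<forall>e\<in>edges G. f1 e * f2 e \<ge> 0))"

definition conformally_indecomposable ::
    "('v, 'e) sgraph \<Rightarrow> ('e \<Rightarrow> bool \<Rightarrow> int) \<Rightarrow> ('e \<Rightarrow> int) \<Rightarrow> bool" where
  "conformally_indecomposable G \<omega> f \<longleftrightarrow>
     nonzero_on_edges G f \<and> \<not> conformally_decomposable G \<omega> f"

end

theory Submission
  imports Defs
begin

text \<open>
  Reverse the edges on which \<open>f\<close> is negative, so that \<open>f\<close> becomes a positive flow on its support.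

  If \<open>f\<close> is indecomposable, a maximal trail that uses every edge \<open>e\<close> at most \<open>f e\<close> times and passes
  each vertex through ends of opposite signs closes up and uses every edge exactly \<open>f e\<close> times.
  No proper part of it is a flow. Hence it visits a vertex at most twice, and then in opposite
  directions, and the visits to two vertices never interlace. So a vertex visited twice is a
  cut-vertex, at which the positive and the negative ends lie on different sides. Splitting all these
  vertices leaves the blocks: the edges used once form circles, the edges used twice are bridges.

  Conversely, let \<open>g\<close> be a flow with \<open>0 \<le> g \<le> I\<^sub>T\<close>, where \<open>I\<^sub>T\<close> is the indicator of a
  circle-tree. The values of \<open>g\<close> at the ends on one side of a cut-vertex have an even sum, because
  each edge contributes an even amount to the total boundary of that side. With the conservation law
  this makes \<open>g / I\<^sub>T\<close> constant at every vertex, so \<open>g\<close> is \<open>0\<close> or \<open>I\<^sub>T\<close> by connectedness.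
\<close>

section \<open>Blocks as edge sets\<close>

text \<open>The obstacle is that a closed part of the trail need not be a flow. The part between two
  visits to \<open>v\<close> has zero boundary if both visits leave through ends of the same sign,
  but boundary 2 or -2 at \<open>v\<close> if the signs are opposite. Minimality excludes the former
  outright, and with it a third visit, since only two signs are available. The latter it excludes
  only in pairs: if the visits to \<open>v\<close> and \<open>w\<close> interlace, two disjoint
  parts leading from \<open>v\<close> to \<open>w\<close> have errors that cancel, so together they
  form a flow. The 2 in the indicator has the same origin: at a vertex visited twice each sign
  carries total value 2, on two ends of a circle or on the one end of a bridge.

  Conversely, balance at a cut-vertex is one equation for the values in two blocks, too little to
  fix the values inside either block; parity on each side supplies the rest.

  The definitions speak of maximal subgraphs and of numbers of components. Both are replaced by
  divisions of edge sets into two sides, the form in which the trail produces cut-vertices.\<close>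

definition inc :: "('v, 'e) sgraph \<Rightarrow> 'e \<Rightarrow> 'v \<Rightarrow> bool" where
  "inc T e v \<longleftrightarrow> (\<exists>b. endv T e b = v)"

definition cover :: "('v, 'e) sgraph \<Rightarrow> 'e set \<Rightarrow> 'v set" where
  "cover T F = {v. \<exists>e\<in>F. inc T e v}"

text \<open>A connected subgraph with at least one edge has no isolated vertices, so its edge set
  determines it. This turns blocks, which are records, into sets of edges.\<close>

definition span :: "('v, 'e) sgraph \<Rightarrow> 'e set \<Rightarrow> ('v, 'e) sgraph" where
  "span T F = T\<lparr>verts := cover T F, edges := F\<rparr>"

text \<open>Connectedness of the span in cut form: no proper part of the edges is vertex-disjoint
  from the rest. Neither walks nor component classes occur in it.\<close>

definition linked :: "('v, 'e) sgraph \<Rightarrow> 'e set \<Rightarrow> bool" where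
  "linked T F \<longleftrightarrow> F \<noteq> {} \<and>
     (\<forall>A\<subseteq>F. A \<noteq> {} \<longrightarrow> A \<noteq> F \<longrightarrow> (\<exists>a\<in>A. \<exists>c\<in>F - A. \<exists>w. inc T a w \<and> inc T c w))"

text \<open>In a connected graph without isolated vertices, \<open>v\<close> is a cut-vertex iff the edges split into two
  nonempty parts that meet in \<open>v\<close> only; this covers the loop clause of the definition as well.
  In a disconnected graph the two parts may be disjoint, and then \<open>v\<close> is arbitrary.\<close>

definition separation :: "('v, 'e) sgraph \<Rightarrow> 'e set \<Rightarrow> 'v \<Rightarrow> 'e set \<Rightarrow> bool" where
  "separation T F v A \<longleftrightarrow> A \<subseteq> F \<and> A \<noteq> {} \<and> A \<noteq> F \<and>
     (\<forall>a\<in>A. \<forall>c\<in>F - A. \<forall>w. inc T a w \<longrightarrow> inc T c w \<longrightarrow> w = v)"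

definition nonseparable :: "('v, 'e) sgraph \<Rightarrow> 'e set \<Rightarrow> bool" where
  "nonseparable T F \<longleftrightarrow> F \<noteq> {} \<and> (\<forall>v A. \<not> separation T F v A)"

definition edge_block :: "('v, 'e) sgraph \<Rightarrow> 'e set \<Rightarrow> bool" where
  "edge_block T F \<longleftrightarrow> F \<subseteq> edges T \<and> nonseparable T F \<and>
     (\<forall>F'\<subseteq>edges T. nonseparable T F' \<longrightarrow> F \<subseteq> F' \<longrightarrow> F' = F)"

lemma span_simps [simp]:
  "verts (span T F) = cover T F" "edges (span T F) = F"
  "endv (span T F) = endv T" "esign (span T F) = esign T"
  by (simp_all add: span_def)

lemma inc_cong: "endv H = endv T \<Longrightarrow> inc H = inc T"
  by (auto simp: inc_def fun_eq_iff)

lemma inc_endv [simp]: "inc T e (endv T e b)"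
  by (auto simp: inc_def)

lemma coverI: "e \<in> F \<Longrightarrow> inc T e v \<Longrightarrow> v \<in> cover T F"
  by (auto simp: cover_def)

lemma coverE:
  assumes "v \<in> cover T F"
  obtains e where "e \<in> F" "inc T e v"
  using assms by (auto simp: cover_def)

lemma endv_in_cover [simp, intro]: "e \<in> F \<Longrightarrow> endv T e b \<in> cover T F"
  by (rule coverI[OF _ inc_endv])

lemma span_sub:
  assumes "endv H = endv T" "esign H = esign T" "verts H = cover T (edges H)"
  shows "H = span T (edges H)"
  using assms by (simp add: span_def)

lemma linkedD:
  assumes "linked T F" "A \<subseteq> F" "A \<noteq> {}" "A \<noteq> F"
  obtains a c w where "a \<in> A" "c \<in> F" "c \<notin> A" "inc T a w" "inc T c w"
  using assms unfolding linked_def by blast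

lemma separationD:
  assumes "separation T F v A" "a \<in> F" "c \<in> F" "inc T a w" "inc T c w" "w \<noteq> v"
  shows "a \<in> A \<longleftrightarrow> c \<in> A"
  using assms unfolding separation_def by blast

lemma separation_compl: "separation T F v A \<Longrightarrow> separation T F v (F - A)"
  unfolding separation_def by blast

lemma nonseparable_linked: "nonseparable T F \<Longrightarrow> linked T F"
  unfolding nonseparable_def linked_def separation_def by blast

lemma nonseparable_singleton: "nonseparable T {e}"
  unfolding nonseparable_def separation_def by blast

text \<open>The restriction to \<open>F\<close> of a separation of \<open>E\<close> is a separation
  of \<open>F\<close>, unless one side becomes empty. This locates blocks relative to a
  cut-vertex.\<close>

lemma nonseparable_side:
  assumes "nonseparable T F" "separation T E v A" "F \<subseteq> E"
  shows "F \<subseteq> A \<or> F \<inter> A = {}"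
proof (rule ccontr)
  assume "\<not> ?thesis"
  then have "separation T F v (F \<inter> A)"
    using assms(2,3) unfolding separation_def by blast
  then show False
    using assms(1) unfolding nonseparable_def by blast
qed

text \<open>A separation of the union leaves each of the two sets on one side, and a common edge
  puts both on the same side. Hence distinct blocks share no edge.\<close>

lemma nonseparable_Un:
  assumes "nonseparable T F" "nonseparable T F'" "F \<inter> F' \<noteq> {}"
  shows "nonseparable T (F \<union> F')"
  unfolding nonseparable_def
proof (intro conjI allI notI)
  show "F \<union> F' = {} \<Longrightarrow> False" using assms(3) by blast
  fix v A assume s: "separation T (F \<union> F') v A"
  then have A: "A \<subseteq> F \<union> F'" "A \<noteq> {}" "A \<noteq> F \<union> F'" unfolding separation_def by simp_all
  obtain x where x: "x \<in> F" "x \<in> F'" using assms(3) by auto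
  have sides: "F \<subseteq> A \<or> F \<inter> A = {}" "F' \<subseteq> A \<or> F' \<inter> A = {}"
    using nonseparable_side[OF assms(1) s Un_upper1] nonseparable_side[OF assms(2) s Un_upper2]
    by simp_all
  show False
  proof (cases "x \<in> A")
    case True
    then have "F \<subseteq> A" "F' \<subseteq> A" using sides x by auto
    then show False using A by auto
  next
    case False
    then have "F \<inter> A = {}" "F' \<inter> A = {}" using sides x by auto
    moreover obtain y where "y \<in> A" using A(2) by auto
    ultimately show False using A(1) by blast
  qed
qed

lemma edge_block_disjoint:
  assumes "edge_block T F" "edge_block T F'" "F \<inter> F' \<noteq> {}"
  shows "F = F'"
proof -
  have "nonseparable T F" "nonseparable T F'" "F \<union> F' \<subseteq> edges T"
    using assms(1,2) unfolding edge_block_def by simp_all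
  then have "nonseparable T (F \<union> F')" "F \<union> F' \<subseteq> edges T"
    using nonseparable_Un[OF _ _ assms(3)] by simp_all
  then have "F \<union> F' = F" "F \<union> F' = F'"
    using assms(1,2) unfolding edge_block_def by (metis Un_upper1, metis Un_upper2)
  then show ?thesis by simp
qed

lemma edge_block_extends:
  assumes "finite (edges T)" "F \<subseteq> edges T" "nonseparable T F"
  obtains F' where "edge_block T F'" "F \<subseteq> F'"
proof -
  let ?S = "{F'. F' \<subseteq> edges T \<and> nonseparable T F'}"
  have "finite ?S" using assms(1) by simp
  then obtain M where "M \<in> ?S" "F \<subseteq> M" "\<forall>F'\<in>?S. M \<subseteq> F' \<longrightarrow> M = F'"
    using finite_has_maximal2[of ?S F] assms(2,3) by auto
  then have "edge_block T M" unfolding edge_block_def by auto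
  then show ?thesis using that \<open>F \<subseteq> M\<close> by blast
qed

section \<open>Connectedness and cut-vertices in terms of edges\<close>

lemma connected_graph_iff:
  "connected_graph H \<longleftrightarrow>
     verts H \<noteq> {} \<and> (\<forall>u\<in>verts H. \<forall>v\<in>verts H. (u, v) \<in> (adjacency H)\<^sup>*)"
proof -
  have sym: "sym (adjacency H)"
  proof (rule symI)
    fix x y assume "(x, y) \<in> adjacency H"
    then obtain e b where "e \<in> edges H" "x = endv H e b" "y = endv H e (\<not> b)"
      unfolding adjacency_def by auto
    then show "(y, x) \<in> adjacency H"
      unfolding adjacency_def by (intro CollectI exI[of _ e] exI[of _ "\<not> b"]) simp
  qed
  have eq: "equiv (verts H) (joined H)"
  proof (rule equivI)
    show "joined H \<subseteq> verts H \<times> verts H" unfolding joined_def by auto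
    show "refl_on (verts H) (joined H)" unfolding joined_def refl_on_def by auto
    show "sym (joined H)" using sym_rtrancl[OF sym] unfolding joined_def sym_def by auto
    show "trans (joined H)" unfolding joined_def trans_def by auto
  qed
  show ?thesis
  proof
    assume "connected_graph H"
    then obtain X where X: "verts H // joined H = {X}"
      unfolding connected_graph_def components_def by (auto simp: card_1_singleton_iff)
    then have "verts H \<noteq> {}" by (auto simp: quotient_def)
    moreover have "(u, v) \<in> joined H" if "u \<in> verts H" "v \<in> verts H" for u v
    proof -
      have "joined H `` {u} = joined H `` {v}"
        using X quotientI[OF that(1), of "joined H"] quotientI[OF that(2), of "joined H"] by simp
      then show ?thesis using eq_equiv_class[OF _ eq that(2)] by simp
    qed
    ultimately show "verts H \<noteq> {} \<and> (\<forall>u\<in>verts H. \<forall>v\<in>verts H. (u, v) \<in> (adjacency H)\<^sup>*)"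
      unfolding joined_def by auto
  next
    assume a: "verts H \<noteq> {} \<and> (\<forall>u\<in>verts H. \<forall>v\<in>verts H. (u, v) \<in> (adjacency H)\<^sup>*)"
    then have "joined H `` {u} = verts H" if "u \<in> verts H" for u
      using that unfolding joined_def by auto
    then have "verts H // joined H = {verts H}"
      using a unfolding quotient_def by auto
    then show "connected_graph H" unfolding connected_graph_def components_def by simp
  qed
qed

text \<open>A graph that is not connected has either several components or none; a pair of mutually
  unreachable vertices rules out the latter.\<close>

lemma card_components_gt_1:
  assumes "finite (verts H)"
  shows "1 < card (components H) \<longleftrightarrow>
     (\<exists>u\<in>verts H. \<exists>v\<in>verts H. (u, v) \<notin> (adjacency H)\<^sup>*)"
proof -
  have fin: "finite (components H)"
    unfolding components_def using assms by (simp add: quotient_def)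
  have "components H = {} \<longleftrightarrow> verts H = {}"
    unfolding components_def quotient_def by auto
  then have "card (components H) = 0 \<longleftrightarrow> verts H = {}"
    using fin by simp
  moreover have "card (components H) = 1 \<longleftrightarrow> connected_graph H"
    unfolding connected_graph_def ..
  ultimately show ?thesis
    unfolding connected_graph_iff
    by (cases "card (components H)"; cases "card (components H) - 1") auto
qed

lemma rtrancl_closed:
  assumes "(u, v) \<in> R\<^sup>*" "u \<in> K" "\<And>x y. (x, y) \<in> R \<Longrightarrow> x \<in> K \<Longrightarrow> y \<in> K"
  shows "v \<in> K"
  using assms by (induction rule: rtrancl_induct) auto

lemma adjacencyE:
  assumes "(x, y) \<in> adjacency H"
  obtains e where "e \<in> edges H" "inc H e x" "inc H e y" "\<And>w. inc H e w \<Longrightarrow> w = x \<or> w = y"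
proof -
  obtain e b where eb: "e \<in> edges H" "x = endv H e b" "y = endv H e (\<not> b)"
    using assms unfolding adjacency_def by auto
  have "w = x \<or> w = y" if w: "inc H e w" for w
  proof -
    obtain c where "endv H e c = w" using w unfolding inc_def by auto
    then show ?thesis using eb by (cases "c = b") auto
  qed
  then show ?thesis using that[of e] eb by simp
qed

lemma adjacencyI:
  assumes "e \<in> edges H" "inc H e x" "inc H e y" "x \<noteq> y"
  shows "(x, y) \<in> adjacency H"
proof -
  obtain b c where bc: "endv H e b = x" "endv H e c = y" using assms unfolding inc_def by auto
  then have "c = (\<not> b)" using assms(4) by (cases b; cases c) auto
  then show ?thesis using bc assms(1) unfolding adjacency_def by auto
qed

lemma reachable_other_end:
  assumes "e \<in> edges H" "inc H e x" "inc H e y" "(u, x) \<in> (adjacency H)\<^sup>*"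
  shows "(u, y) \<in> (adjacency H)\<^sup>*"
  using adjacencyI[OF assms(1-3)] assms(4) by (cases "x = y") auto

lemma connected_iff_linked:
  assumes "verts H = cover H (edges H)"
  shows "connected_graph H \<longleftrightarrow> linked H (edges H)"
proof
  assume c: "connected_graph H"
  show "linked H (edges H)"
    unfolding linked_def
  proof (intro conjI allI impI)
    show "edges H \<noteq> {}" using c assms unfolding connected_graph_iff cover_def by auto
    fix A assume A: "A \<subseteq> edges H" "A \<noteq> {}" "A \<noteq> edges H"
    show "\<exists>a\<in>A. \<exists>c\<in>edges H - A. \<exists>w. inc H a w \<and> inc H c w"
    proof (rule ccontr)
      assume no: "\<not> ?thesis"
      obtain a where a: "a \<in> A" using A by auto
      obtain c' where c': "c' \<in> edges H" "c' \<notin> A" using A by auto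
      let ?u = "endv H a False" and ?v = "endv H c' False"
      have "?u \<in> verts H" "?v \<in> verts H" using a c' A assms by auto
      then have "(?u, ?v) \<in> (adjacency H)\<^sup>*" using c unfolding connected_graph_iff by auto
      moreover have "?u \<in> cover H A" using a by auto
      ultimately have "?v \<in> cover H A"
      proof (rule rtrancl_closed)
        fix x y assume "(x, y) \<in> adjacency H" "x \<in> cover H A"
        then show "y \<in> cover H A"
          using no by (elim adjacencyE) (auto simp: cover_def)
      qed
      then obtain a' where "a' \<in> A" "inc H a' ?v" by (rule coverE)
      then show False using no c' inc_endv[of H c' False] by blast
    qed
  qed
next
  assume l: "linked H (edges H)"
  show "connected_graph H"
    unfolding connected_graph_iff
  proof (intro conjI ballI)
    obtain e where "e \<in> edges H" using l unfolding linked_def by auto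
    then show "verts H \<noteq> {}" using assms endv_in_cover[of e "edges H" H False] by auto
    fix u v assume uv: "u \<in> verts H" "v \<in> verts H"
    \<comment> \<open>These are the edges reached from \<open>u\<close>. Linkedness would provide a
      next edge if some were missing.\<close>
    let ?A = "{e \<in> edges H. \<exists>w. inc H e w \<and> (u, w) \<in> (adjacency H)\<^sup>*}"
    have "?A = edges H"
    proof (rule ccontr)
      assume ne: "?A \<noteq> edges H"
      have "?A \<noteq> {}" using uv assms unfolding cover_def by auto
      then obtain a c w where "a \<in> ?A" "c \<in> edges H" "c \<notin> ?A" "inc H a w" "inc H c w"
        using linkedD[OF l _ _ ne] by blast
      then show False using reachable_other_end[of a H _ w u] by auto
    qed
    moreover obtain e where "e \<in> edges H" "inc H e v"
      using uv assms unfolding cover_def by auto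
    ultimately show "(u, v) \<in> (adjacency H)\<^sup>*"
      using reachable_other_end[of e H _ v u] by blast
  qed
qed

lemma inc_delete_vertex [simp]: "inc (delete_vertex H v) = inc H"
  by (rule inc_cong) (simp add: delete_vertex_def)

lemma in_edges_delete_vertex:
  "e \<in> edges (delete_vertex H v) \<longleftrightarrow> e \<in> edges H \<and> \<not> inc H e v"
  by (auto simp: delete_vertex_def inc_def)

text \<open>If deleting \<open>v\<close> disconnects \<open>x\<close> from \<open>y\<close>, the
  edges reachable from \<open>x\<close> without passing \<open>v\<close> form one side. Conversely,
  each side has an edge at \<open>v\<close>. Either both edges have another end, and these ends are
  disconnected by deleting \<open>v\<close>, or one edge is a loop, which the second clause of the
  definition of a cut-vertex covers.\<close>

lemma cut_vertex_iff_separation: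
  assumes fin: "finite (verts H)" and iso: "verts H = cover H (edges H)"
    and lk: "linked H (edges H)"
  shows "cut_vertex H v \<longleftrightarrow> (\<exists>A. separation H (edges H) v A)"
proof
  let ?D = "delete_vertex H v"
  have cD: "card (components H) = 1"
    using lk connected_iff_linked[OF iso] unfolding connected_graph_def by simp
  have vD: "verts ?D = verts H - {v}" by (simp add: delete_vertex_def)
  have finD: "finite (verts ?D)" using fin vD by simp
  {
    assume cv: "cut_vertex H v"
    show "\<exists>A. separation H (edges H) v A"
    proof (cases "1 < card (components ?D)")
      case True
      then obtain x y where xy: "x \<in> verts H" "x \<noteq> v" "y \<in> verts H" "y \<noteq> v"
          "(x, y) \<notin> (adjacency ?D)\<^sup>*"
        using card_components_gt_1[OF finD] vD by auto
      define A where "A = {e \<in> edges H. \<exists>w. inc H e w \<and> w \<noteq> v \<and> (x, w) \<in> (adjacency ?D)\<^sup>*}"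
      have step: "(x, w') \<in> (adjacency ?D)\<^sup>*"
        if *: "e \<in> A" "inc H e w'" "w' \<noteq> v" for e w'
      proof -
        obtain w where w: "e \<in> edges H" "inc H e w" "w \<noteq> v" "(x, w) \<in> (adjacency ?D)\<^sup>*"
          using *(1) unfolding A_def by auto
        show ?thesis
        proof (cases "w = w'")
          case False
          have "\<not> inc H e v"
          proof
            assume "inc H e v"
            then obtain b1 b2 b3 where "endv H e b1 = v" "endv H e b2 = w" "endv H e b3 = w'"
              using *(2) w(2) unfolding inc_def by auto
            then show False using False *(3) w(3) by (cases b1; cases b2; cases b3) auto
          qed
          then have "e \<in> edges ?D" using w(1) in_edges_delete_vertex[of e H v] by auto
          then show ?thesis using reachable_other_end[of e ?D w w'] * w by auto
        qed (use w in auto)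
      qed
      obtain e where "e \<in> edges H" "inc H e x" using xy(1) iso unfolding cover_def by auto
      then have "A \<noteq> {}" using xy(2) unfolding A_def by blast
      moreover obtain e' where "e' \<in> edges H" "inc H e' y"
        using xy(3) iso unfolding cover_def by auto
      then have "A \<noteq> edges H" using step[of e' y] xy(4,5) by auto
      moreover have "A \<subseteq> edges H" unfolding A_def by auto
      moreover have "w = v" if "a \<in> A" "c \<in> edges H - A" "inc H a w" "inc H c w" for a c w
      proof (rule ccontr)
        assume "w \<noteq> v"
        then have "c \<in> A" using step[OF that(1,3)] that(2,4) unfolding A_def by blast
        then show False using that(2) by simp
      qed
      ultimately show ?thesis unfolding separation_def by blast
    next
      case False
      then obtain e e' b where "e \<in> edges H" "\<forall>b. endv H e b = v" "e' \<in> edges H" "e' \<noteq> e"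
          "endv H e' b = v"
        using cv cD unfolding cut_vertex_def by auto
      then have "separation H (edges H) v {e}"
        unfolding separation_def by (auto simp: inc_def)
      then show ?thesis by blast
    qed
  next
    assume "\<exists>A. separation H (edges H) v A"
    then obtain A where A: "separation H (edges H) v A" by blast
    have As: "A \<subseteq> edges H" "A \<noteq> {}" "A \<noteq> edges H" using A unfolding separation_def by simp_all
    obtain a c w where acw: "a \<in> A" "c \<in> edges H" "c \<notin> A" "inc H a w" "inc H c w"
      by (rule linkedD[OF lk As])
    have "w = v" using separationD[OF A, of a c w] acw As by auto
    with acw As have ac: "a \<in> A" "a \<in> edges H" "c \<in> edges H" "c \<notin> A" "inc H a v" "inc H c v"
      by auto
    have v: "v \<in> verts H" using ac iso unfolding cover_def by auto
    consider "\<forall>b. endv H a b = v" | "\<forall>b. endv H c b = v"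
      | b b' where "endv H a b \<noteq> v" "endv H c b' \<noteq> v" by blast
    then show "cut_vertex H v"
    proof cases
      case 1
      moreover have "\<exists>b. endv H c b = v" "c \<noteq> a" using ac unfolding inc_def by auto
      ultimately show ?thesis using ac(2,3) v unfolding cut_vertex_def by blast
    next
      case 2
      moreover have "\<exists>b. endv H a b = v" "a \<noteq> c" using ac unfolding inc_def by auto
      ultimately show ?thesis using ac(2,3) v unfolding cut_vertex_def by blast
    next
      case 3
      let ?x = "endv H a b" and ?y = "endv H c b'"
      \<comment> \<open>Without \<open>v\<close>, only vertices of \<open>A\<close> can be reached
        from \<open>?x\<close>, whereas \<open>?y\<close> is an end of the edge \<open>c\<close> on
        the other side.\<close>
      have "(?x, ?y) \<notin> (adjacency ?D)\<^sup>*"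
      proof
        assume "(?x, ?y) \<in> (adjacency ?D)\<^sup>*"
        moreover have "?x \<in> cover H A - {v}" using ac 3 by auto
        ultimately have "?y \<in> cover H A - {v}"
        proof (rule rtrancl_closed)
          fix x y assume xy: "(x, y) \<in> adjacency ?D" and x: "x \<in> cover H A - {v}"
          obtain e where "e \<in> edges ?D" "inc ?D e x" "inc ?D e y"
            using adjacencyE[OF xy] by blast
          then have e: "e \<in> edges H" "\<not> inc H e v" "inc H e x" "inc H e y"
            by (simp_all add: in_edges_delete_vertex)
          obtain a' where "a' \<in> A" "inc H a' x" "x \<noteq> v" using x unfolding cover_def by auto
          moreover have "A \<subseteq> edges H" using A unfolding separation_def by auto
          ultimately have "e \<in> A" using separationD[OF A, of a' e x] e by auto
          then show "y \<in> cover H A - {v}" using e unfolding cover_def by auto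
        qed
        then obtain a' where "a' \<in> A" "inc H a' ?y" by (auto elim: coverE)
        moreover have "A \<subseteq> edges H" using A unfolding separation_def by auto
        ultimately show False using separationD[OF A, of a' c ?y] ac 3 by auto
      qed
      moreover have "?x \<in> verts ?D" "?y \<in> verts ?D"
        using ac 3 iso vD by auto
      ultimately have "1 < card (components ?D)"
        using card_components_gt_1[OF finD] by blast
      then show ?thesis using v cD unfolding cut_vertex_def by simp
    qed
  }
qed

section \<open>Blocks as maximal nonseparable edge sets\<close>

locale isolated_free =
  fixes T :: "('v, 'e) sgraph"
  assumes graph: "signed_graph T" and verts_eq: "verts T = cover T (edges T)"
begin

lemma fin_edges: "finite (edges T)" and fin_verts: "finite (verts T)"
  using graph unfolding signed_graph_def by auto

lemma subgraph_span: "F \<subseteq> edges T \<Longrightarrow> subgraph (span T F) T"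
proof -
  assume F: "F \<subseteq> edges T"
  then have "cover T F \<subseteq> verts T" using verts_eq unfolding cover_def by auto
  then have "finite (cover T F)" "finite F"
    using fin_verts fin_edges F by (auto intro: finite_subset)
  moreover have "\<forall>e\<in>F. \<forall>b. endv T e b \<in> cover T F" by auto
  ultimately show ?thesis
    using graph F \<open>cover T F \<subseteq> verts T\<close> unfolding subgraph_def signed_graph_def by auto
qed

lemma connected_span: "connected_graph (span T F) \<longleftrightarrow> linked T F"
proof -
  have i: "inc (span T F) = inc T" by (rule inc_cong) simp
  have "verts (span T F) = cover (span T F) (edges (span T F))"
    using i by (simp add: cover_def)
  from connected_iff_linked[OF this] show ?thesis using i by (simp add: linked_def)
qed

lemma cut_vertex_span:
  assumes "F \<subseteq> edges T" "linked T F"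
  shows "cut_vertex (span T F) v \<longleftrightarrow> (\<exists>A. separation T F v A)"
proof -
  have i: "inc (span T F) = inc T" by (rule inc_cong) simp
  have "finite (verts (span T F))"
    using subgraph_span[OF assms(1)] unfolding subgraph_def signed_graph_def by simp
  from cut_vertex_iff_separation[OF this] show ?thesis
    using i assms(2) by (simp add: linked_def cover_def separation_def)
qed

lemma nonseparable_span:
  assumes "F \<subseteq> edges T" "F \<noteq> {}"
  shows "connected_without_cut_vertices (span T F) \<longleftrightarrow> nonseparable T F"
proof (cases "linked T F")
  case True
  then show ?thesis
    using assms(2) connected_span[of F] cut_vertex_span[OF assms(1) True]
    unfolding connected_without_cut_vertices_def nonseparable_def by simp
next
  case False
  then show ?thesis
    using connected_span[of F] nonseparable_linked[of T F]
    unfolding connected_without_cut_vertices_def by auto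
qed

text \<open>A walk that starts at an end of an edge visits ends of edges only, so no vertex of
  \<open>H\<close> is isolated.\<close>

lemma subgraph_connected_span:
  assumes "subgraph H T" "connected_graph H" "edges H \<noteq> {}"
  shows "H = span T (edges H)"
proof -
  have i: "inc H = inc T" by (rule inc_cong) (use assms(1) in \<open>simp add: subgraph_def\<close>)
  have "v \<in> cover T (edges H)" if v: "v \<in> verts H" for v
  proof -
    obtain e where e: "e \<in> edges H" using assms(3) by auto
    let ?u = "endv H e False"
    have "?u \<in> verts H" using assms(1) e unfolding subgraph_def signed_graph_def by auto
    then have "(?u, v) \<in> (adjacency H)\<^sup>*"
      using assms(2) v unfolding connected_graph_iff by auto
    moreover have "?u \<in> cover H (edges H)" using e by auto
    ultimately have "v \<in> cover H (edges H)"
    proof (rule rtrancl_closed)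
      fix x y assume xy: "(x, y) \<in> adjacency H"
      show "y \<in> cover H (edges H)" by (rule adjacencyE[OF xy]) (rule coverI)
    qed
    then show ?thesis using i by (simp add: cover_def)
  qed
  moreover have "cover T (edges H) \<subseteq> verts H"
    using assms(1) unfolding subgraph_def signed_graph_def cover_def inc_def by auto
  ultimately show ?thesis
    using assms(1) unfolding subgraph_def by (intro span_sub) auto
qed

lemma cut_vertex_T:
  "linked T (edges T) \<Longrightarrow> cut_vertex T v \<longleftrightarrow> (\<exists>A. separation T (edges T) v A)"
  using cut_vertex_iff_separation[OF fin_verts verts_eq] by simp

text \<open>A block without edges would be a single vertex. By \<open>verts_eq\<close> this vertex
  lies on an edge, which alone spans a larger connected graph without cut-vertices. All other blocks
  are spans, and maximality passes between the two formulations.\<close>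

lemma block_iff: "block T B \<longleftrightarrow> (\<exists>F. edge_block T F \<and> B = span T F)"
proof
  assume b: "block T B"
  then have sB: "subgraph B T" and nB: "connected_without_cut_vertices B"
    unfolding block_def by simp_all
  have mB: "B' = B"
    if "subgraph B' T" "connected_without_cut_vertices B'" "subgraph B B'" for B'
    using b that unfolding block_def by blast
  have ne: "edges B \<noteq> {}"
  proof
    assume e: "edges B = {}"
    have c: "connected_graph B" using nB unfolding connected_without_cut_vertices_def by simp
    have "adjacency B = {}" using e unfolding adjacency_def by auto
    then have "(adjacency B)\<^sup>* = Id" by simp
    with c obtain v where v: "verts B = {v}" unfolding connected_graph_iff by auto
    then have "v \<in> cover T (edges T)" using sB verts_eq unfolding subgraph_def by auto
    then obtain g where g: "g \<in> edges T" "inc T g v" unfolding cover_def by auto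
    have "subgraph (span T {g}) T" "connected_without_cut_vertices (span T {g})"
      using g subgraph_span[of "{g}"] nonseparable_span[of "{g}"] nonseparable_singleton[of T g]
      by auto
    moreover have "subgraph B (span T {g})"
      using sB e v g unfolding subgraph_def by (auto simp: cover_def)
    ultimately have "span T {g} = B" by (rule mB)
    then have "edges B = {g}" by (metis span_simps(2))
    then show False using e by simp
  qed
  have BF: "B = span T (edges B)"
    using subgraph_connected_span[OF sB _ ne] nB
    unfolding connected_without_cut_vertices_def by auto
  have sub: "edges B \<subseteq> edges T" using sB unfolding subgraph_def by auto
  have "edge_block T (edges B)"
    unfolding edge_block_def
  proof (intro conjI allI impI)
    show "nonseparable T (edges B)" using nB BF nonseparable_span[OF sub ne] by simp
    fix F' assume F': "F' \<subseteq> edges T" "nonseparable T F'" "edges B \<subseteq> F'"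
    have "subgraph (span T F') T" "connected_without_cut_vertices (span T F')"
      using F' subgraph_span[of F'] nonseparable_span[of F'] ne by auto
    moreover have "verts B = cover T (edges B)"
      by (subst BF) simp
    then have "subgraph B (span T F')"
      using sB F' unfolding subgraph_def by (auto simp: cover_def)
    ultimately have "span T F' = B" by (rule mB)
    then show "F' = edges B" by (metis span_simps(2))
  qed (rule sub)
  then show "\<exists>F. edge_block T F \<and> B = span T F" using BF by blast
next
  assume "\<exists>F. edge_block T F \<and> B = span T F"
  then obtain F where F: "edge_block T F" and B: "B = span T F" by blast
  have Fe: "F \<subseteq> edges T" "F \<noteq> {}" "nonseparable T F"
    using F unfolding edge_block_def nonseparable_def by auto
  show "block T B"
    unfolding block_def
  proof (intro conjI allI impI)
    show "subgraph B T" "connected_without_cut_vertices B"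
      using B Fe subgraph_span nonseparable_span by auto
    fix B' assume B': "subgraph B' T" "connected_without_cut_vertices B'" "subgraph B B'"
    then have FB': "F \<subseteq> edges B'" using B unfolding subgraph_def by auto
    then have ne: "edges B' \<noteq> {}" using Fe by auto
    have *: "B' = span T (edges B')"
      using subgraph_connected_span[OF B'(1) _ ne] B'(2)
      unfolding connected_without_cut_vertices_def by auto
    have s': "edges B' \<subseteq> edges T" using B'(1) unfolding subgraph_def by auto
    have "nonseparable T (edges B')"
      using nonseparable_span[OF s' ne] B'(2) * by simp
    then have "edges B' = F" using F FB' s' unfolding edge_block_def by auto
    then show "B' = B" using * B by simp
  qed
qed

lemma span_inj: "span T F = span T F' \<longleftrightarrow> F = F'"
  by (metis span_simps(2))

end

section \<open>Parity and the indicator of a circle-tree\<close>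

definition ends :: "('v, 'e) sgraph \<Rightarrow> 'e set \<Rightarrow> 'v \<Rightarrow> ('e \<times> bool) set" where
  "ends T F v = {(e, b). e \<in> F \<and> endv T e b = v}"

lemma ends_at_span [simp]: "ends_at (span T F) v = ends T F v"
  by (simp add: ends_at_def ends_def)

lemma ends_at_ends: "ends_at T v = ends T (edges T) v"
  by (simp add: ends_at_def ends_def)

lemma finite_ends: "finite F \<Longrightarrow> finite (ends T F v)"
  by (rule finite_subset[of _ "F \<times> UNIV"]) (auto simp: ends_def)

lemma ends_incE:
  assumes "inc T e v" "e \<in> F"
  obtains b where "(e, b) \<in> ends T F v"
  using assms unfolding inc_def ends_def by auto

lemma ends_cong:
  assumes "\<And>e. inc T e v \<Longrightarrow> e \<in> F \<longleftrightarrow> e \<in> F'"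
  shows "ends T F v = ends T F' v"
  using assms unfolding ends_def by (auto simp: inc_def)

lemma ends_Un_side:
  assumes "A \<subseteq> F"
  shows "ends T F v = ends T A v \<union> ends T (F - A) v" "ends T A v \<inter> ends T (F - A) v = {}"
  using assms unfolding ends_def by auto

text \<open>Every edge has exactly two ends; the left side groups them by vertex. \<open>V\<close>
  may exceed the cover, so that an exceptional vertex can be adjoined.\<close>

lemma sum_ends:
  assumes "finite F" "finite V" "cover T F \<subseteq> V"
  shows "(\<Sum>v\<in>V. \<Sum>(e, b)\<in>ends T F v. \<phi> e b) = (\<Sum>e\<in>F. \<phi> e False + \<phi> e True)"
proof -
  have "(\<Sum>v\<in>V. \<Sum>(e, b)\<in>ends T F v. \<phi> e b)
      = (\<Sum>v\<in>V. \<Sum>p\<in>{x \<in> F \<times> UNIV. case_prod (endv T) x = v}. case_prod \<phi> p)"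
    by (intro sum.cong) (auto simp: ends_def)
  also have "\<dots> = (\<Sum>p\<in>F \<times> UNIV. case_prod \<phi> p)"
    using assms by (intro sum.group) (auto intro: subsetD)
  also have "\<dots> = (\<Sum>e\<in>F. \<phi> e False + \<phi> e True)"
    by (simp add: sum.cartesian_product[symmetric] UNIV_bool add.commute)
  finally show ?thesis .
qed

text \<open>The multiplicative form turns the sign of a circle, a product over edges, into a product
  of local factors at its vertices.\<close>

lemma prod_ends:
  assumes "finite F" "finite V" "cover T F \<subseteq> V"
  shows "(\<Prod>v\<in>V. \<Prod>(e, b)\<in>ends T F v. \<phi> e b) = (\<Prod>e\<in>F. \<phi> e False * \<phi> e True)"
proof -
  have "(\<Prod>v\<in>V. \<Prod>(e, b)\<in>ends T F v. \<phi> e b)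
      = (\<Prod>v\<in>V. \<Prod>p\<in>{x \<in> F \<times> UNIV. case_prod (endv T) x = v}. case_prod \<phi> p)"
    by (intro prod.cong) (auto simp: ends_def)
  also have "\<dots> = (\<Prod>p\<in>F \<times> UNIV. case_prod \<phi> p)"
    using assms by (intro prod.group) (auto intro: subsetD)
  also have "\<dots> = (\<Prod>e\<in>F. \<phi> e False * \<phi> e True)"
    by (simp add: prod.cartesian_product[symmetric] UNIV_bool mult.commute)
  finally show ?thesis .
qed

lemma finite_cover:
  assumes "finite F"
  shows "finite (cover T F)"
proof -
  have "cover T F = (\<Union>e\<in>F. range (endv T e))"
    unfolding cover_def inc_def by auto
  then show ?thesis using assms by simp
qed

text \<open>Handshake argument: summed over all vertices, both ends of an edge contribute, and their
  contributions agree modulo 2.\<close>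

lemma even_exceptional_vertex:
  fixes s :: "'e \<Rightarrow> bool \<Rightarrow> int"
  assumes fin: "finite A" and par: "\<And>e. e \<in> A \<Longrightarrow> even (s e False + s e True)"
    and bal: "\<And>w. w \<in> cover T A \<Longrightarrow> w \<noteq> v \<Longrightarrow> even (\<Sum>(e, b)\<in>ends T A w. s e b * g e)"
  shows "even (\<Sum>(e, b)\<in>ends T A v. s e b * g e)"
proof -
  let ?V = "insert v (cover T A)"
  let ?h = "\<lambda>w. \<Sum>(e, b)\<in>ends T A w. s e b * g e"
  have fV: "finite ?V" using finite_cover[OF fin] by simp
  have "even (\<Sum>w\<in>?V - {v}. ?h w)" by (rule dvd_sum, rule bal) auto
  moreover have "even (\<Sum>e\<in>A. (s e False + s e True) * g e)" using par by (intro dvd_sum) auto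
  then have "even (\<Sum>w\<in>?V. ?h w)"
    using sum_ends[OF fin fV subset_insertI, of "\<lambda>e b. s e b * g e"]
    by (simp only: distrib_right)
  then have "even (?h v + (\<Sum>w\<in>?V - {v}. ?h w))"
    using fV by (subst (asm) sum.remove[of _ v]) auto
  ultimately show ?thesis by (simp only: even_add)
qed

lemma ends_side:
  assumes "separation T F v A" "w \<noteq> v" "w \<in> cover T A"
  shows "ends T A w = ends T F w"
proof -
  have AF: "A \<subseteq> F" using assms(1) unfolding separation_def by simp
  obtain a where a: "a \<in> A" "inc T a w" using assms(3) by (rule coverE)
  have "e \<in> A" if "e \<in> F" "endv T e b = w" for e b
    using separationD[OF assms(1), of a e w] a that AF assms(2) unfolding inc_def by auto
  then show ?thesis using AF unfolding ends_def by auto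
qed

lemma separation_incident:
  assumes "linked T F" "separation T F v A"
  obtains a c where "a \<in> A" "c \<in> F - A" "inc T a v" "inc T c v"
proof -
  have A: "A \<subseteq> F" "A \<noteq> {}" "A \<noteq> F" using assms(2) unfolding separation_def by simp_all
  obtain a c w where acw: "a \<in> A" "c \<in> F" "c \<notin> A" "inc T a w" "inc T c w"
    by (rule linkedD[OF assms(1) A])
  then have "w = v" using separationD[OF assms(2), of a c w] A by auto
  then show ?thesis using that acw by auto
qed

text \<open>By the handshake argument with all values 1, each side of a separation at
  \<open>v\<close> has an even number of ends at \<open>v\<close>. Both numbers are positive, so two
  ends are too few.\<close>

lemma two_regular_nonseparable:
  assumes fin: "finite F" and lk: "linked T F"
    and deg: "\<And>v. v \<in> cover T F \<Longrightarrow> card (ends T F v) = 2"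
  shows "nonseparable T F"
  unfolding nonseparable_def
proof (intro conjI allI notI)
  show "F = {} \<Longrightarrow> False" using lk unfolding linked_def by simp
  fix v A assume s: "separation T F v A"
  have ev: "even (card (ends T B v))" if B: "separation T F v B" for B
  proof -
    have BF: "B \<subseteq> F" using B unfolding separation_def by simp
    have "even (\<Sum>(e, b)\<in>ends T B v. (1::int) * 1)"
    proof (rule even_exceptional_vertex)
      show "finite B" using BF fin by (rule finite_subset)
      fix w assume w: "w \<in> cover T B" "w \<noteq> v"
      then have "w \<in> cover T F" using BF unfolding cover_def by auto
      then show "even (\<Sum>(e, b)\<in>ends T B w. (1::int) * 1)"
        using ends_side[OF B w(2,1)] deg by simp
    qed simp
    then show ?thesis by simp
  qed
  obtain a c where ac: "a \<in> A" "c \<in> F - A" "inc T a v" "inc T c v"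
    by (rule separation_incident[OF lk s])
  have AF: "A \<subseteq> F" using s unfolding separation_def by simp
  then have fins: "finite (ends T A v)" "finite (ends T (F - A) v)"
    using fin by (auto intro!: finite_ends intro: finite_subset)
  have "ends T A v \<noteq> {}" "ends T (F - A) v \<noteq> {}"
    using ac by (auto elim: ends_incE)
  then have "card (ends T A v) \<noteq> 0" "card (ends T (F - A) v) \<noteq> 0" using fins by auto
  moreover have "card (ends T F v) = card (ends T A v) + card (ends T (F - A) v)"
    using ends_Un_side[OF AF, of T v] fins card_Un_disjoint by metis
  moreover have "v \<in> cover T F" using ac AF by (auto intro: coverI)
  then have "card (ends T F v) = 2" by (rule deg)
  ultimately show False using ev[OF s] ev[OF separation_compl[OF s]] by presburger
qed

text \<open>If the side fell into two vertex-disjoint parts, each of them could be linked to the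
  rest of \<open>F\<close> only through \<open>x\<close>, and so the two parts would meet
  there.\<close>

lemma linked_side:
  assumes "linked T F" "separation T F x A"
  shows "linked T A"
  unfolding linked_def
proof (intro conjI allI impI)
  have A: "A \<subseteq> F" "A \<noteq> {}" "A \<noteq> F" using assms(2) unfolding separation_def by simp_all
  then show "A \<noteq> {}" by simp
  fix B assume B: "B \<subseteq> A" "B \<noteq> {}" "B \<noteq> A"
  show "\<exists>a\<in>B. \<exists>c\<in>A - B. \<exists>w. inc T a w \<and> inc T c w"
  proof (rule ccontr)
    assume no: "\<not> ?thesis"
    have at_x: "\<exists>d\<in>D. inc T d x" if D: "D = B \<or> D = A - B" for D
    proof -
      have "D \<subseteq> F" "D \<noteq> {}" "D \<noteq> F" using D A B by auto
      then obtain a c w where acw: "a \<in> D" "c \<in> F" "c \<notin> D" "inc T a w" "inc T c w"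
        by (rule linkedD[OF assms(1)])
      have aA: "a \<in> A" using D acw B by auto
      then have "c \<notin> A" using no D acw by blast
      then have "w = x" using separationD[OF assms(2), of a c w] aA A acw by auto
      then show ?thesis using acw by blast
    qed
    show False using at_x[of B] at_x[of "A - B"] no by blast
  qed
qed

text \<open>This puts all edges at a vertex that is no cut-vertex into one block. If another vertex
  \<open>x\<close> separates \<open>F\<close>, the induction passes to the side with the edges at
  \<open>v\<close>. A separation of that side at \<open>v\<close> would extend to \<open>F\<close>,
  because one of its parts avoids \<open>x\<close>.\<close>

lemma edges_at_noncut_nonseparable:
  assumes "finite F" "linked T F" "v \<in> cover T F" "\<And>A. \<not> separation T F v A"
  shows "\<exists>D\<subseteq>F. nonseparable T D \<and> (\<forall>e\<in>F. inc T e v \<longrightarrow> e \<in> D)"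
  using assms
proof (induction F rule: finite_psubset_induct)
  case (psubset F)
  show ?case
  proof (cases "nonseparable T F")
    case True
    then show ?thesis by blast
  next
    case False
    moreover have "F \<noteq> {}" using psubset.prems(1) unfolding linked_def by simp
    ultimately obtain x A0 where A0: "separation T F x A0" unfolding nonseparable_def by blast
    have xv: "x \<noteq> v" using A0 psubset.prems(3) by auto
    obtain e where e: "e \<in> F" "inc T e v" using psubset.prems(2) by (rule coverE)
    define A where "A = (if e \<in> A0 then A0 else F - A0)"
    have A: "separation T F x A" "e \<in> A"
      using A0 separation_compl[OF A0] e unfolding A_def by auto
    have AF: "A \<subseteq> F" "A \<noteq> {}" "A \<noteq> F" using A(1) unfolding separation_def by simp_all
    have nosep: "\<not> separation T A v B0" for B0
    proof
      assume B0: "separation T A v B0"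
      \<comment> \<open>Edges at \<open>x\<close> occur in at most one part of a separation at
        \<open>v\<close>, as \<open>x\<close> differs from \<open>v\<close>; \<open>B\<close> is a
        part without them.\<close>
      define B where "B = (if \<exists>b\<in>B0. inc T b x then A - B0 else B0)"
      have B: "separation T A v B" using B0 separation_compl[OF B0] unfolding B_def by simp
      have "B0 \<subseteq> A" using B0 unfolding separation_def by simp
      then have Bx: "\<not> inc T b x" if "b \<in> B" for b
        using that separationD[OF B0, of _ b x] xv unfolding B_def
        by (auto split: if_splits)
      have BA: "B \<subseteq> A" "B \<noteq> {}" "B \<noteq> A" using B unfolding separation_def by simp_all
      have "w = v" if bc: "b \<in> B" "c \<in> F - B" "inc T b w" "inc T c w" for b c w
      proof (cases "c \<in> A")
        case True
        then show ?thesis using separationD[OF B, of b c w] bc BA by auto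
      next
        case False
        then have "w = x" using separationD[OF A(1), of b c w] bc BA AF by auto
        then show ?thesis using Bx bc by auto
      qed
      then have "separation T F v B" using BA AF unfolding separation_def by blast
      then show False using psubset.prems(3) by simp
    qed
    have "A \<subset> F" "v \<in> cover T A" using AF A(2) e(2) by (auto intro: coverI)
    then obtain D where D: "D \<subseteq> A" "nonseparable T D" "\<forall>e\<in>A. inc T e v \<longrightarrow> e \<in> D"
      using psubset.IH[of A] linked_side[OF psubset.prems(1) A(1)] nosep by blast
    have "d \<in> A" if "d \<in> F" "inc T d v" for d
      using separationD[OF A(1), of e d v] that e xv A(2) by auto
    then show ?thesis using D AF by (intro exI[of _ D]) auto
  qed
qed

lemma card_2_ends:
  assumes "card (ends T F v) = 2"
  obtains e b e' b' where "ends T F v = {(e, b), (e', b')}" "(e, b) \<noteq> (e', b')"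
  using assms by (auto simp: card_2_iff)

section \<open>Minimality of the indicator of a circle-tree\<close>

context isolated_free
begin

lemma finite_sub: "F \<subseteq> edges T \<Longrightarrow> finite F"
  using fin_edges by (rule finite_subset[rotated])

lemma circle_span:
  "circle (span T F) \<longleftrightarrow> linked T F \<and> (\<forall>v\<in>cover T F. card (ends T F v) = 2)"
  by (simp add: circle_def connected_span degree_def)

lemma single_edge_span: "single_edge (span T F) \<longleftrightarrow> (\<exists>e. F = {e})"
proof -
  have "cover T {e} = range (endv T e)" for e
    unfolding cover_def inc_def by auto
  then show ?thesis by (auto simp: single_edge_def)
qed

lemma circle_block_span:
  "circle_block T C \<longleftrightarrow> (\<exists>F. edge_block T F \<and> circle (span T F) \<and> C = span T F)"
  unfolding circle_block_def block_iff by auto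

text \<open>If both ends of \<open>e\<close> were at \<open>v\<close>, the edge would be a loop, and
  a loop is a circle.\<close>

lemma ends_noncircle_edge:
  assumes "\<not> circle (span T {e})" "inc T e v"
  obtains b where "ends T {e} v = {(e, b)}"
proof -
  obtain b where b: "endv T e b = v" using assms(2) unfolding inc_def by auto
  have "endv T e (\<not> b) \<noteq> v"
  proof
    assume l: "endv T e (\<not> b) = v"
    have all: "endv T e c = v" for c using b l by (cases "c = b") auto
    then have "cover T {e} = {v}" "ends T {e} v = {(e, False), (e, True)}"
      unfolding cover_def inc_def ends_def by auto
    then have "circle (span T {e})"
      using nonseparable_linked[OF nonseparable_singleton] by (simp add: circle_span)
    then show False using assms(1) by simp
  qed
  then have "endv T e c = v \<longleftrightarrow> c = b" for c using b by (cases b; cases c) simp_all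
  then have "ends T {e} v = {(e, b)}"
    unfolding ends_def by auto
  then show ?thesis by (rule that)
qed

lemma indicator_circle:
  assumes "edge_block T F" "circle (span T F)" "e \<in> F"
  shows "tree_indicator T e = 1"
  unfolding tree_indicator_def using assms circle_block_span by auto

text \<open>An edge lies in only one block, so the case of circle blocks in the indicator is
  excluded.\<close>

lemma indicator_noncircle:
  assumes "edge_block T F" "\<not> circle (span T F)" "e \<in> F" "tree_indicator T e \<noteq> 0"
  shows "tree_indicator T e = 2"
proof -
  have "\<not> (\<exists>C. circle_block T C \<and> e \<in> edges C)"
  proof
    assume "\<exists>C. circle_block T C \<and> e \<in> edges C"
    then obtain F' where F': "edge_block T F'" "circle (span T F')" "e \<in> F'"
      unfolding circle_block_span by auto
    then have "F = F'" using edge_block_disjoint[OF assms(1) F'(1)] assms(3) by auto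
    then show False using F' assms(2) by simp
  qed
  then show ?thesis using assms(4) unfolding tree_indicator_def by (auto split: if_splits)
qed

lemma edge_in_block:
  assumes "e \<in> edges T"
  obtains F where "edge_block T F" "e \<in> F"
  using edge_block_extends[OF fin_edges, of "{e}"] nonseparable_singleton[of T e] assms by auto

lemma circle_tree_block:
  assumes "circle_tree T" "edge_block T F"
  obtains "circle (span T F)" | e where "\<not> circle (span T F)" "F = {e}"
  using assms single_edge_span[of F] block_iff unfolding circle_tree_def by blast

lemma indicator_flow_minimal:
  assumes ct: "circle_tree T" and dir: "direction T s"
    and supp: "\<And>e. e \<in> edges T \<Longrightarrow> tree_indicator T e \<noteq> 0"
    and flow: "\<And>v. v \<in> verts T \<Longrightarrow> boundary T s (tree_indicator T) v = 0"
    and g: "\<And>e. e \<in> edges T \<Longrightarrow> 0 \<le> g e \<and> g e \<le> tree_indicator T e"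
    and gflow: "\<And>v. v \<in> verts T \<Longrightarrow> boundary T s g v = 0"
  shows "(\<forall>e\<in>edges T. g e = 0) \<or> (\<forall>e\<in>edges T. g e = tree_indicator T e)"
proof -
  let ?E = "edges T" and ?I = "tree_indicator T"
  have lk: "linked T ?E"
    using ct connected_iff_linked[OF verts_eq] unfolding circle_tree_def by simp
  have sgn: "s e b = 1 \<or> s e b = -1" if "e \<in> ?E" for e b
    using dir that unfolding direction_def orientation_def by auto
  have bd: "boundary T s h v = (\<Sum>(e, b)\<in>ends T ?E v. s e b * h e)" for h v
    by (simp add: boundary_def ends_at_ends)
  \<comment> \<open>\<open>c\<close> is the ratio of \<open>g\<close> to the indicator on the edges
    of \<open>F\<close> at \<open>v\<close>, and \<open>t\<close> is the sign of the ends of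
    \<open>F\<close> there. The factor 2 comes from two ends of value \<open>c\<close> on a circle,
    or from one end of value \<open>2 * c\<close> on a bridge.\<close>
  have side: "\<exists>c t. (c = 0 \<or> c = 1) \<and> (t = 1 \<or> t = -1) \<and> (\<forall>e\<in>F. inc T e v \<longrightarrow> g e = c * ?I e)
      \<and> (\<Sum>(e, b)\<in>ends T F v. s e b * g e) = 2 * t * c"
    if F: "edge_block T F" "v \<in> cover T F" and cut: "cut_vertex T v"
      and A: "separation T ?E v A" "ends T A v = ends T F v" for F v A
  proof -
    have FE: "F \<subseteq> ?E" using F unfolding edge_block_def by simp
    have AE: "A \<subseteq> ?E" using A unfolding separation_def by simp
    have even: "even (\<Sum>(e, b)\<in>ends T F v. s e b * g e)"
      unfolding A(2)[symmetric]
    proof (rule even_exceptional_vertex)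
      show "finite A" using AE by (rule finite_sub)
      show "even (s e False + s e True)" if "e \<in> A" for e
      proof -
        have "e \<in> ?E" using that AE by auto
        then show ?thesis using sgn[of e False] sgn[of e True] by auto
      qed
      fix w assume w: "w \<in> cover T A" "w \<noteq> v"
      then have "w \<in> verts T" using AE verts_eq unfolding cover_def by auto
      then show "even (\<Sum>(e, b)\<in>ends T A w. s e b * g e)"
        using ends_side[OF A(1) w(2,1)] gflow[of w] bd by simp
    qed
    from ct F(1) show ?thesis
    proof (cases rule: circle_tree_block)
      case 1
      then have "card (ends T F v) = 2" using F(2) circle_span by simp
      then obtain e b e' b' where d: "ends T F v = {(e, b), (e', b')}" "(e, b) \<noteq> (e', b')"
        by (rule card_2_ends)
      then have ee: "e \<in> F" "e' \<in> F" unfolding ends_def by auto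
      have I: "?I e = 1" "?I e' = 1" using indicator_circle[OF F(1) 1] ee by auto
      \<comment> \<open>Equal signs at the two ends turn the even signed sum into an even sum of two
        values from 0 and 1, so these values agree.\<close>
      have "sink (span T F) s v \<or> source (span T F) s v"
      proof -
        have "circle_block T (span T F)" using F(1) 1 circle_block_span by blast
        moreover have "v \<in> verts (span T F)" using F(2) by simp
        ultimately show ?thesis using dir cut unfolding direction_def by blast
      qed
      then have "s e b = s e' b'" using d unfolding sink_def source_def by auto
      then have sum: "(\<Sum>(e, b)\<in>ends T F v. s e b * g e) = s e b * (g e + g e')"
        using d by (simp add: distrib_left)
      have sg: "s e b = 1 \<or> s e b = -1" using sgn ee FE by blast
      then have "even (g e + g e')" using even sum by auto
      moreover have "g e = 0 \<or> g e = 1" "g e' = 0 \<or> g e' = 1"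
        using g[of e] g[of e'] I ee FE by force+
      ultimately have gg: "g e = g e'" by auto
      have "g f = g e * ?I f" if f: "f \<in> F" "inc T f v" for f
      proof -
        obtain b where "(f, b) \<in> ends T F v" by (rule ends_incE[OF f(2,1)])
        then have "f = e \<or> f = e'" unfolding d(1) by blast
        then show ?thesis using gg I by (elim disjE) simp_all
      qed
      then show ?thesis
        using sum gg \<open>g e = 0 \<or> g e = 1\<close> sg
        by (intro exI[of _ "g e"] exI[of _ "s e b"]) simp
    next
      case (2 e)
      have "inc T e v" using F(2) 2 unfolding cover_def by auto
      then obtain b where d: "ends T F v = {(e, b)}"
        using ends_noncircle_edge 2 by metis
      have eE: "e \<in> ?E" using FE 2 by auto
      have I: "?I e = 2" using indicator_noncircle[OF F(1) 2(1)] 2 supp[OF eE] by auto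
      have sum: "(\<Sum>(e, b)\<in>ends T F v. s e b * g e) = s e b * g e" using d by simp
      then have "even (g e)" using even sgn[OF eE, of b] by auto
      then obtain c where c: "g e = 2 * c" by (elim evenE)
      then have "c = 0 \<or> c = 1" using g[OF eE] I by auto
      then show ?thesis
        using sum c I sgn[OF eE, of b] 2 by (intro exI[of _ c] exI[of _ "s e b"]) auto
    qed
  qed
  \<comment> \<open>The ratio of \<open>g\<close> to the indicator is the same for all edges at
    \<open>v\<close>, written without division.\<close>
  have at_v: "g e * ?I e' = g e' * ?I e"
    if e: "e \<in> ?E" "e' \<in> ?E" "inc T e v" "inc T e' v" for e e' v
  proof -
    have vV: "v \<in> verts T" using e verts_eq by (auto intro: coverI)
    show ?thesis
    proof (cases "cut_vertex T v")
      case True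
      then obtain A where A: "separation T ?E v A" using cut_vertex_T[OF lk] by auto
      have "card {B. block T B \<and> v \<in> verts B} = 2" using ct True unfolding circle_tree_def by simp
      then obtain B1 B2 where B12: "{B. block T B \<and> v \<in> verts B} = {B1, B2}"
        by (auto simp: card_2_iff)
      then have "block T B1" "block T B2" by blast+
      then obtain F1 F2 where "B1 = span T F1" "B2 = span T F2"
        unfolding block_iff by blast
      with B12 have F12: "{B. block T B \<and> v \<in> verts B} = {span T F1, span T F2}"
        by simp
      have at12: "F = F1 \<or> F = F2" if "edge_block T F" "v \<in> cover T F" for F
      proof -
        have "span T F \<in> {B. block T B \<and> v \<in> verts B}" using that block_iff by auto
        then show ?thesis using F12 span_inj by auto
      qed
      have inF: "f \<in> F1 \<or> f \<in> F2" if "f \<in> ?E" "inc T f v" for f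
        using edge_in_block[OF that(1)] at12 that(2) coverI by metis
      have "span T F1 \<in> {B. block T B \<and> v \<in> verts B}" "span T F2 \<in> {B. block T B \<and> v \<in> verts B}"
        using F12 by auto
      then have F: "edge_block T F1" "edge_block T F2" "v \<in> cover T F1" "v \<in> cover T F2"
        using block_iff span_inj by auto
      have FE: "F1 \<subseteq> ?E" "F2 \<subseteq> ?E" and FA: "F1 \<subseteq> A \<or> F1 \<inter> A = {}" "F2 \<subseteq> A \<or> F2 \<inter> A = {}"
        using F(1,2) nonseparable_side[OF _ A, of F1] nonseparable_side[OF _ A, of F2]
        unfolding edge_block_def by auto
      obtain a c where ac: "a \<in> A" "c \<in> ?E - A" "inc T a v" "inc T c v"
        by (rule separation_incident[OF lk A])
      have AE: "A \<subseteq> ?E" using A unfolding separation_def by simp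
      \<comment> \<open>The two blocks at \<open>v\<close> lie on different sides of the separation;
        \<open>A1\<close> is the side of \<open>F1\<close>, that is, \<open>A\<close> or its
        complement.\<close>
      have split: "\<exists>A1. separation T ?E v A1 \<and> ends T A1 v = ends T F1 v
                   \<and> ends T (?E - A1) v = ends T F2 v"
      proof -
        have "a \<in> F1 \<or> a \<in> F2" "c \<in> F1 \<or> c \<in> F2" using inF ac AE by auto
        then consider "F1 \<subseteq> A" "F2 \<inter> A = {}" | "F2 \<subseteq> A" "F1 \<inter> A = {}"
          using FA ac by blast
        then show ?thesis
        proof cases
          case 1
          have "ends T A v = ends T F1 v" "ends T (?E - A) v = ends T F2 v"
            by (rule ends_cong, use inF FE AE 1 in blast)+
          then show ?thesis using A by blast
        next
          case 2
          have "ends T (?E - A) v = ends T F1 v" "ends T (?E - (?E - A)) v = ends T F2 v"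
            by (rule ends_cong, use inF FE AE 2 in blast)+
          then show ?thesis using separation_compl[OF A] by blast
        qed
      qed
      then obtain A1 where A1: "separation T ?E v A1" "ends T A1 v = ends T F1 v"
        "ends T (?E - A1) v = ends T F2 v" by blast
      obtain c1 t1 where 1: "c1 = 0 \<or> c1 = 1" "t1 = 1 \<or> t1 = -1"
        "\<forall>e\<in>F1. inc T e v \<longrightarrow> g e = c1 * ?I e" "(\<Sum>(e, b)\<in>ends T F1 v. s e b * g e) = 2 * t1 * c1"
        using side[OF F(1,3) True A1(1,2)] by blast
      obtain c2 t2 where 2: "c2 = 0 \<or> c2 = 1" "t2 = 1 \<or> t2 = -1"
        "\<forall>e\<in>F2. inc T e v \<longrightarrow> g e = c2 * ?I e" "(\<Sum>(e, b)\<in>ends T F2 v. s e b * g e) = 2 * t2 * c2"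
        using side[OF F(2,4) True separation_compl[OF A1(1)] A1(3)] by blast
      have "A1 \<subseteq> ?E" using A1 unfolding separation_def by simp
      then have "(\<Sum>(e, b)\<in>ends T ?E v. s e b * g e)
          = (\<Sum>(e, b)\<in>ends T A1 v. s e b * g e) + (\<Sum>(e, b)\<in>ends T (?E - A1) v. s e b * g e)"
        using ends_Un_side[of A1 ?E T v] finite_ends finite_sub
        by (metis (no_types, lifting) Diff_subset sum.union_disjoint)
      then have "2 * t1 * c1 + 2 * t2 * c2 = 0"
        using gflow[OF vV] bd[of g v] A1 1(4) 2(4) by simp
      then have "c1 = c2" using 1(1,2) 2(1,2) by auto
      then have "g f = c1 * ?I f" if "f \<in> ?E" "inc T f v" for f
        using inF[OF that] 1(3) 2(3) that by auto
      then show ?thesis using e by simp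
    next
      case False
      \<comment> \<open>All edges at \<open>v\<close> now lie in one block. If it is a circle,
        balance of the indicator makes the two signs at \<open>v\<close> opposite, and then balance
        of \<open>g\<close> makes the two values equal.\<close>
      then have "\<not> separation T ?E v A" for A using cut_vertex_T[OF lk] by auto
      then obtain D where D: "D \<subseteq> ?E" "nonseparable T D" "\<forall>e\<in>?E. inc T e v \<longrightarrow> e \<in> D"
        using edges_at_noncut_nonseparable[OF fin_edges lk] vV verts_eq by metis
      obtain F where F: "edge_block T F" "D \<subseteq> F"
        by (rule edge_block_extends[OF fin_edges D(1,2)])
      have FE: "F \<subseteq> ?E" using F unfolding edge_block_def by simp
      have all: "ends T ?E v = ends T F v" using D(3) F(2) FE by (intro ends_cong) auto
      have eF: "e \<in> F" "e' \<in> F" using D(3) F(2) e by auto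
      from ct F(1) show ?thesis
      proof (cases rule: circle_tree_block)
        case 1
        then have "card (ends T F v) = 2" using eF e coverI circle_span by metis
        then obtain e1 b1 e2 b2 where d: "ends T F v = {(e1, b1), (e2, b2)}" "(e1, b1) \<noteq> (e2, b2)"
          by (rule card_2_ends)
        then have ee: "e1 \<in> F" "e2 \<in> F" unfolding ends_def by auto
        have I: "?I e1 = 1" "?I e2 = 1" using indicator_circle[OF F(1) 1] ee by auto
        have "s e1 b1 + s e2 b2 = 0" "s e1 b1 * g e1 + s e2 b2 * g e2 = 0"
          using flow[OF vV] gflow[OF vV] bd[of ?I v] bd[of g v] all d I by simp_all
        moreover have "s e1 b1 = 1 \<or> s e1 b1 = -1" "s e2 b2 = 1 \<or> s e2 b2 = -1"
          using sgn ee FE by blast+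
        ultimately have "g e1 = g e2" by auto
        moreover have "e \<in> {e1, e2}" "e' \<in> {e1, e2}"
          using e d eF unfolding ends_def inc_def by auto
        ultimately show ?thesis using I by auto
      next
        case (2 f)
        then have "e = f" "e' = f" using eF by auto
        then show ?thesis by simp
      qed
    qed
  qed
  \<comment> \<open>An edge of value 2 lies on a block path, whose ends are on circle blocks; so
    circle blocks exist in any case. On an edge of value 1 the ratio is \<open>g\<close> itself,
    hence 0 or 1.\<close>
  have "\<exists>e\<in>?E. ?I e = 1"
  proof -
    obtain e where e: "e \<in> ?E" using lk unfolding linked_def by auto
    obtain F where F: "edge_block T F" "e \<in> F" using e by (rule edge_in_block)
    have "\<exists>C. circle_block T C"
      using supp[OF e] unfolding tree_indicator_def block_path_def by (auto split: if_splits)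
    then obtain F' where F': "edge_block T F'" "circle (span T F')"
      unfolding circle_block_span by auto
    then obtain e' where "e' \<in> F'" "F' \<subseteq> ?E"
      unfolding edge_block_def nonseparable_def by auto
    then show ?thesis using indicator_circle[OF F'] by auto
  qed
  then obtain e0 where e0: "e0 \<in> ?E" "?I e0 = 1" by auto
  define A where "A = {e \<in> ?E. g e = g e0 * ?I e}"
  have "A = ?E"
  proof (rule ccontr)
    assume ne: "A \<noteq> ?E"
    have "A \<subseteq> ?E" "A \<noteq> {}" using e0 unfolding A_def by auto
    then obtain a c w where acw: "a \<in> A" "c \<in> ?E" "c \<notin> A" "inc T a w" "inc T c w"
      using ne by (rule linkedD[OF lk])
    then have "a \<in> ?E" "g a = g e0 * ?I a" unfolding A_def by auto
    have "g c * ?I a = g a * ?I c" using at_v[of a c w] acw \<open>a \<in> ?E\<close> by simp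
    also have "\<dots> = (g e0 * ?I c) * ?I a" using \<open>g a = g e0 * ?I a\<close> by simp
    finally have "g c * ?I a = (g e0 * ?I c) * ?I a" .
    then have "g c = g e0 * ?I c" using supp[OF \<open>a \<in> ?E\<close>] by simp
    then show False using acw unfolding A_def by simp
  qed
  then have "g e = g e0 * ?I e" if "e \<in> ?E" for e using that unfolding A_def by auto
  moreover have "g e0 = 0 \<or> g e0 = 1" using g[OF e0(1)] e0(2) by auto
  ultimately show ?thesis by auto
qed

end

section \<open>Reduction to positive flows\<close>

lemma boundary_cong:
  assumes "\<And>e b. e \<in> edges T \<Longrightarrow> s e b * g e = s' e b * g' e"
  shows "boundary T s g v = boundary T s' g' v"
  unfolding boundary_def using assms by (intro sum.cong) (auto simp: ends_at_def)

lemma boundary_diff: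
  "boundary T s (\<lambda>e. g e - g' e) v = boundary T s g v - boundary T s g' v"
  by (simp add: boundary_def sum_subtractf[symmetric] right_diff_distrib case_prod_beta)

lemma boundary_sum:
  "boundary T s (\<lambda>e. \<Sum>i\<in>I. g i e) v = (\<Sum>i\<in>I. boundary T s (g i) v)"
proof -
  have "boundary T s (\<lambda>e. \<Sum>i\<in>I. g i e) v = (\<Sum>p\<in>ends_at T v. \<Sum>i\<in>I. s (fst p) (snd p) * g i (fst p))"
    by (simp add: boundary_def case_prod_beta sum_distrib_left)
  also have "\<dots> = (\<Sum>i\<in>I. boundary T s (g i) v)"
    by (subst sum.swap) (simp add: boundary_def case_prod_beta)
  finally show ?thesis .
qed

text \<open>Every indecomposable flow takes this form after reversing the edges on which it is
  negative.\<close>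

definition minimal_flow ::
    "('v, 'e) sgraph \<Rightarrow> ('e \<Rightarrow> bool \<Rightarrow> int) \<Rightarrow> ('e \<Rightarrow> int) \<Rightarrow> bool" where
  "minimal_flow T s h \<longleftrightarrow> edges T \<noteq> {} \<and> (\<forall>e\<in>edges T. 0 < h e) \<and> integral_flow T s h \<and>
     (\<forall>g. (\<forall>e\<in>edges T. 0 \<le> g e \<and> g e \<le> h e) \<longrightarrow> integral_flow T s g \<longrightarrow>
        (\<forall>e\<in>edges T. g e = 0) \<or> (\<forall>e\<in>edges T. g e = h e))"

lemma tree_indicator_nonneg: "0 \<le> tree_indicator T e"
  unfolding tree_indicator_def by simp

section \<open>Passing to the support and reversing negative edges\<close>

locale flow_support =
  fixes G :: "('v, 'e) sgraph" and \<omega> :: "'e \<Rightarrow> bool \<Rightarrow> int" and f :: "'e \<Rightarrow> int"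
  assumes G: "signed_graph G" and ori: "orientation G \<omega>" and flow: "integral_flow G \<omega> f"
begin

abbreviation "S \<equiv> support G f"

text \<open>This is \<open>\<omega>\<close> with the negative edges reversed. It vanishes where
  \<open>f\<close> does, so it is an orientation of the support only. It also serves as the
  direction in the theorem, since its coupling with \<open>\<omega>\<close> is the sign of
  \<open>f\<close>.\<close>

definition sigma :: "'e \<Rightarrow> bool \<Rightarrow> int" where
  "sigma e b = \<omega> e b * sgn (f e)"

lemma S_simps [simp]:
  "edges S = {e \<in> edges G. f e \<noteq> 0}" "endv S = endv G" "esign S = esign G"
  by (simp_all add: support_def)

lemma inc_S [simp]: "inc S = inc G"
  by (rule inc_cong) simp

lemma verts_S: "verts S = cover S (edges S)"
  by (auto simp: support_def cover_def inc_def)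

sublocale isolated_free S
proof
  have "finite (edges S)" using G unfolding signed_graph_def by simp
  moreover have "endv S e b \<in> verts S" if "e \<in> edges S" for e b
    using that verts_S endv_in_cover by metis
  ultimately show "signed_graph S"
    using G finite_cover[of "edges S" S] verts_S unfolding signed_graph_def by auto
qed (rule verts_S)

lemma verts_S_subset: "verts S \<subseteq> verts G"
  using G by (auto simp: support_def signed_graph_def)

lemma orientation_sigma: "orientation S sigma"
  using ori unfolding orientation_def sigma_def by (auto simp: sgn_if)

text \<open>The factor \<open>sgn (f e)\<close> removes the ends outside the support, so sums over
  the ends in \<open>G\<close> and in \<open>S\<close> agree.\<close>

lemma boundary_sigma:
  "boundary S sigma g v = boundary G \<omega> (\<lambda>e. sgn (f e) * g e) v"
proof -
  have fin: "finite (ends_at G v)"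
    unfolding ends_at_ends using G by (intro finite_ends) (simp add: signed_graph_def)
  show ?thesis
    unfolding boundary_def
    by (rule sum.mono_neutral_cong_left[OF fin]) (auto simp: ends_at_def sigma_def)
qed

lemma integral_flow_sigma:
  "integral_flow S sigma g \<longleftrightarrow> integral_flow G \<omega> (\<lambda>e. sgn (f e) * g e)"
proof -
  have "boundary S sigma g v = 0" if "v \<notin> verts S" for v
  proof -
    have "ends_at S v = {}" using that by (auto simp: ends_at_def support_def)
    then show ?thesis by (simp add: boundary_def)
  qed
  then show ?thesis
    using verts_S_subset unfolding integral_flow_def boundary_sigma[symmetric] by blast
qed

text \<open>On the edges of \<open>G\<close>, the conformal summands of \<open>f\<close> are the
  functions \<open>sgn (f e) * g e\<close> with \<open>g\<close> between 0 and the absolute value of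
  \<open>f\<close>. A vanishing summand means that \<open>g\<close> is one of the two
  bounds.\<close>

lemma indecomposable_iff:
  "conformally_indecomposable G \<omega> f \<longleftrightarrow> minimal_flow S sigma (\<lambda>e. \<bar>f e\<bar>)"
proof
  assume ind: "conformally_indecomposable G \<omega> f"
  show "minimal_flow S sigma (\<lambda>e. \<bar>f e\<bar>)"
    unfolding minimal_flow_def
  proof (intro conjI allI impI)
    show "edges S \<noteq> {}"
      using ind unfolding conformally_indecomposable_def nonzero_on_edges_def by auto
    show "\<forall>e\<in>edges S. 0 < \<bar>f e\<bar>" by simp
    show "integral_flow S sigma (\<lambda>e. \<bar>f e\<bar>)"
      unfolding integral_flow_sigma using flow by (simp add: sgn_mult_abs)
    fix g assume g: "\<forall>e\<in>edges S. 0 \<le> g e \<and> g e \<le> \<bar>f e\<bar>" "integral_flow S sigma g"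
    define f1 where "f1 = (\<lambda>e. sgn (f e) * g e)"
    have i1: "integral_flow G \<omega> f1" using g(2) unfolding integral_flow_sigma f1_def .
    then have i2: "integral_flow G \<omega> (\<lambda>e. f e - f1 e)"
      using flow unfolding integral_flow_def boundary_diff by simp
    have "f1 e * (f e - f1 e) \<ge> 0" if "e \<in> edges G" for e
    proof (cases "f e" "0::int" rule: linorder_cases)
      case less
      then have "0 \<le> g e" "g e \<le> - f e" using g that by force+
      then have "0 \<le> g e * (- f e - g e)" by simp
      then show ?thesis using less by (simp add: f1_def algebra_simps)
    next
      case greater
      then have "0 \<le> g e" "g e \<le> f e" using g that by force+
      then have "0 \<le> g e * (f e - g e)" by simp
      then show ?thesis using greater by (simp add: f1_def algebra_simps)
    qed (simp add: f1_def)
    then have "\<not> nonzero_on_edges G f1 \<or> \<not> nonzero_on_edges G (\<lambda>e. f e - f1 e)"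
      using ind i1 i2
      unfolding conformally_indecomposable_def conformally_decomposable_def by force
    then show "(\<forall>e\<in>edges S. g e = 0) \<or> (\<forall>e\<in>edges S. g e = \<bar>f e\<bar>)"
    proof
      assume "\<not> nonzero_on_edges G f1"
      then show ?thesis unfolding nonzero_on_edges_def f1_def by (auto simp: sgn_eq_0_iff)
    next
      assume a: "\<not> nonzero_on_edges G (\<lambda>e. f e - f1 e)"
      have "g e = \<bar>f e\<bar>" if "e \<in> edges S" for e
      proof -
        have "f e = sgn (f e) * g e" "f e \<noteq> 0"
          using a that unfolding nonzero_on_edges_def f1_def by auto
        then show ?thesis by (auto simp: sgn_if split: if_splits)
      qed
      then show ?thesis by blast
    qed
  qed
next
  assume min: "minimal_flow S sigma (\<lambda>e. \<bar>f e\<bar>)"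
  have nz: "nonzero_on_edges G f"
    using min unfolding minimal_flow_def nonzero_on_edges_def by auto
  moreover have "\<not> conformally_decomposable G \<omega> f"
  proof
    assume "conformally_decomposable G \<omega> f"
    then obtain f1 f2 where d: "integral_flow G \<omega> f1" "integral_flow G \<omega> f2"
      "nonzero_on_edges G f1" "nonzero_on_edges G f2"
      "\<And>e. e \<in> edges G \<Longrightarrow> f e = f1 e + f2 e" "\<And>e. e \<in> edges G \<Longrightarrow> f1 e * f2 e \<ge> 0"
      unfolding conformally_decomposable_def by blast
    define g where "g = (\<lambda>e. sgn (f e) * f1 e)"
    have conf: "0 \<le> g e \<and> g e \<le> \<bar>f e\<bar> \<and> sgn (f e) * g e = f1 e"
        if e: "e \<in> edges G" for e
    proof -
      have "(0 \<le> f1 e \<and> 0 \<le> f2 e) \<or> (f1 e \<le> 0 \<and> f2 e \<le> 0)"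
        using d(6)[OF e] by (simp add: zero_le_mult_iff)
      then show ?thesis using d(5)[OF e] unfolding g_def by (auto simp: sgn_if)
    qed
    have "boundary G \<omega> (\<lambda>e. sgn (f e) * g e) v = boundary G \<omega> f1 v" for v
      by (rule boundary_cong) (simp add: conf)
    then have "integral_flow S sigma g"
      using d(1) unfolding integral_flow_sigma by (simp add: integral_flow_def)
    moreover have "\<forall>e\<in>edges S. 0 \<le> g e \<and> g e \<le> \<bar>f e\<bar>" using conf by simp
    ultimately have "(\<forall>e\<in>edges S. g e = 0) \<or> (\<forall>e\<in>edges S. g e = \<bar>f e\<bar>)"
      using min unfolding minimal_flow_def by blast
    then show False
    proof
      assume z: "\<forall>e\<in>edges S. g e = 0"
      have "f1 e = 0" if "e \<in> edges G" for e
        using conf[OF that] z that by (cases "f e = 0") auto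
      then show False using d(3) unfolding nonzero_on_edges_def by blast
    next
      assume z: "\<forall>e\<in>edges S. g e = \<bar>f e\<bar>"
      have "f2 e = 0" if "e \<in> edges G" for e
      proof (cases "f e = 0")
        case False
        then have "f1 e = sgn (f e) * \<bar>f e\<bar>" using conf[OF that] z that by auto
        then show ?thesis using d(5)[OF that] by (simp add: sgn_mult_abs)
      next
        case True
        then show ?thesis using conf[OF that] d(5)[OF that] by auto
      qed
      then show False using d(4) unfolding nonzero_on_edges_def by blast
    qed
  qed
  ultimately show "conformally_indecomposable G \<omega> f"
    unfolding conformally_indecomposable_def by blast
qed

lemma circle_tree_indecomposable:
  assumes ct: "circle_tree S" and dir: "direction S \<omega>\<^sub>f"
    and feq: "\<And>e. e \<in> edges G \<Longrightarrow> f e = coupling G \<omega> S \<omega>\<^sub>f e * tree_indicator S e"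
  shows "conformally_indecomposable G \<omega> f"
proof -
  have ori': "orientation S \<omega>\<^sub>f" using dir unfolding direction_def by simp
  \<comment> \<open>The coupling is a sign and the indicator is nonnegative, so the equation for
    \<open>f\<close> determines both: the indicator is the absolute value of \<open>f\<close>, and
    \<open>\<omega>\<^sub>f\<close> agrees with \<open>sigma\<close>.\<close>
  have *: "\<bar>f e\<bar> = tree_indicator S e \<and> \<omega>\<^sub>f e b = sigma e b" if e: "e \<in> edges S" for e b
  proof -
    have eG: "e \<in> edges G" "f e \<noteq> 0" using e by auto
    have "coupling G \<omega> S \<omega>\<^sub>f e = \<omega> e b * \<omega>\<^sub>f e b"
      by (rule coupling_either_end[OF ori ori']) (use e eG in auto)
    then have fe: "f e = \<omega> e b * \<omega>\<^sub>f e b * tree_indicator S e" using feq[OF eG(1)] by simp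
    moreover have "\<omega> e b = 1 \<or> \<omega> e b = -1" "\<omega>\<^sub>f e b = 1 \<or> \<omega>\<^sub>f e b = -1"
      using ori ori' e eG unfolding orientation_def by auto
    moreover have "0 < tree_indicator S e"
      using tree_indicator_nonneg[of S e] fe eG(2) by (cases "tree_indicator S e = 0") auto
    ultimately show ?thesis unfolding sigma_def by (auto simp: sgn_if)
  qed
  have bd: "boundary S \<omega>\<^sub>f g v = boundary S sigma g v" for g v
    by (rule boundary_cong) (use * in auto)
  have lk: "edges S \<noteq> {}" using ct unfolding circle_tree_def by simp
  have "integral_flow S sigma (\<lambda>e. \<bar>f e\<bar>)"
    unfolding integral_flow_sigma using flow by (simp add: sgn_mult_abs)
  moreover have "boundary S sigma (\<lambda>e. \<bar>f e\<bar>) v = boundary S sigma (tree_indicator S) v" for v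
    by (rule boundary_cong) (use * in auto)
  ultimately have fl: "boundary S \<omega>\<^sub>f (tree_indicator S) v = 0" if "v \<in> verts S" for v
    using that bd unfolding integral_flow_def by simp
  have "minimal_flow S sigma (\<lambda>e. \<bar>f e\<bar>)"
    unfolding minimal_flow_def
  proof (intro conjI allI impI)
    fix g assume g: "\<forall>e\<in>edges S. 0 \<le> g e \<and> g e \<le> \<bar>f e\<bar>" "integral_flow S sigma g"
    have "(\<forall>e\<in>edges S. g e = 0) \<or> (\<forall>e\<in>edges S. g e = tree_indicator S e)"
    proof (rule indicator_flow_minimal[OF ct dir _ fl])
      show "tree_indicator S e \<noteq> 0" if "e \<in> edges S" for e
        using *[OF that] that by auto
      show "0 \<le> g e \<and> g e \<le> tree_indicator S e" if "e \<in> edges S" for e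
        using g(1) *[OF that] that by metis
      show "boundary S \<omega>\<^sub>f g v = 0" if "v \<in> verts S" for v
        using g(2) that bd unfolding integral_flow_def by simp
    qed
    then show "(\<forall>e\<in>edges S. g e = 0) \<or> (\<forall>e\<in>edges S. g e = \<bar>f e\<bar>)"
      using * by metis
  qed (use lk \<open>integral_flow S sigma (\<lambda>e. \<bar>f e\<bar>)\<close> in auto)
  then show ?thesis by (simp add: indecomposable_iff)
qed

end

section \<open>Closed trails of a minimal flow\<close>

locale minimal_flow_graph = isolated_free T for T :: "('v, 'e) sgraph" +
  fixes s :: "'e \<Rightarrow> bool \<Rightarrow> int" and h :: "'e \<Rightarrow> int"
  assumes orient: "orientation T s" and minimal: "minimal_flow T s h"
begin

lemma sign_cases: "e \<in> edges T \<Longrightarrow> s e b = 1 \<or> s e b = -1"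
  using orient unfolding orientation_def by auto

lemma pos: "e \<in> edges T \<Longrightarrow> 0 < h e"
  using minimal unfolding minimal_flow_def by auto

lemma endv_verts: "e \<in> edges T \<Longrightarrow> endv T e b \<in> verts T"
  using verts_eq by auto

text \<open>An end \<open>(e, b)\<close> doubles as the traversal of \<open>e\<close> that starts at this end. A state
  \<open>(v, \<sigma>)\<close> is a vertex together with the sign of the end through which it is left; it is entered
  through an end of sign \<open>-\<sigma>\<close>, whence the sign in \<open>arrive\<close>.\<close>

definition leave :: "'e \<times> bool \<Rightarrow> 'v \<times> int" where
  "leave d = (endv T (fst d) (snd d), s (fst d) (snd d))"

definition arrive :: "'e \<times> bool \<Rightarrow> 'v \<times> int" where
  "arrive d = (endv T (fst d) (\<not> snd d), - s (fst d) (\<not> snd d))"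

text \<open>The contribution to the boundary of leaving in state \<open>p\<close>. Arriving in state
  \<open>p\<close> contributes the negative, because \<open>arrive\<close> reverses the
  sign.\<close>

definition dirac :: "'v \<times> int \<Rightarrow> 'v \<Rightarrow> int" where
  "dirac p v = (if fst p = v then snd p else 0)"

text \<open>Counting over an arbitrary set of times allows parts of a trail to be tested as
  flows.\<close>

definition uses :: "(nat \<Rightarrow> 'e \<times> bool) \<Rightarrow> nat set \<Rightarrow> 'e \<Rightarrow> int" where
  "uses D I e = (\<Sum>i\<in>I. if fst (D i) = e then 1 else 0)"

lemma boundary_unit:
  assumes "e \<in> edges T"
  shows "boundary T s (\<lambda>e'. if e = e' then 1 else 0) v
     = (if endv T e False = v then s e False else 0) + (if endv T e True = v then s e True else 0)"
proof -
  have "boundary T s (\<lambda>e'. if e = e' then 1 else 0) v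
      = (\<Sum>(e', b)\<in>ends T {e} v. s e' b * (if e = e' then 1 else 0))"
    unfolding boundary_def ends_at_ends using assms finite_ends[OF fin_edges]
    by (intro sum.mono_neutral_right) (auto simp: ends_def split: if_splits)
  also have "ends T {e} v = (\<lambda>b. (e, b)) ` {b. endv T e b = v}"
    unfolding ends_def by auto
  also have "(\<Sum>(e', b)\<in>\<dots>. s e' b * (if e = e' then 1 else 0))
      = (\<Sum>b\<in>{b. endv T e b = v}. s e b)"
    by (subst sum.reindex) (auto simp: inj_on_def)
  also have "\<dots> = (\<Sum>b\<in>UNIV. if endv T e b = v then s e b else 0)"
    by (subst sum.inter_filter[symmetric]) auto
  finally show ?thesis by (simp add: UNIV_bool add.commute)
qed

text \<open>When each arrival is the next departure, this sum telescopes, and only the ends of a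
  part of the trail remain.\<close>

lemma boundary_uses:
  assumes "\<And>i. i \<in> I \<Longrightarrow> fst (D i) \<in> edges T"
  shows "boundary T s (uses D I) v = (\<Sum>i\<in>I. dirac (leave (D i)) v - dirac (arrive (D i)) v)"
proof -
  have "boundary T s (uses D I) v
      = (\<Sum>i\<in>I. boundary T s (\<lambda>e'. if fst (D i) = e' then 1 else 0) v)"
    unfolding uses_def by (rule boundary_sum)
  also have "\<dots> = (\<Sum>i\<in>I. dirac (leave (D i)) v - dirac (arrive (D i)) v)"
  proof (rule sum.cong[OF refl])
    fix i assume "i \<in> I"
    then show "boundary T s (\<lambda>e'. if fst (D i) = e' then 1 else 0) v
        = dirac (leave (D i)) v - dirac (arrive (D i)) v"
      using boundary_unit[OF assms[of i]]
      by (cases "snd (D i)") (auto simp: dirac_def leave_def arrive_def)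
  qed
  finally show ?thesis .
qed

definition trail :: "(nat \<Rightarrow> 'e \<times> bool) \<Rightarrow> nat \<Rightarrow> bool" where
  "trail D n \<longleftrightarrow> (\<forall>i<n. fst (D i) \<in> edges T) \<and>
     (\<forall>i. Suc i < n \<longrightarrow> arrive (D i) = leave (D (Suc i))) \<and>
     (\<forall>e\<in>edges T. uses D {..<n} e \<le> h e)"

lemma trail_bounded:
  assumes "trail D n"
  shows "n \<le> nat (\<Sum>e\<in>edges T. h e)"
proof -
  have "(\<Sum>e\<in>edges T. uses D {..<n} e) = (\<Sum>i<n. \<Sum>e\<in>edges T. if fst (D i) = e then 1 else 0)"
    unfolding uses_def by (rule sum.swap)
  also have "\<dots> = (\<Sum>i<n. 1)"
    using assms fin_edges unfolding trail_def by (intro sum.cong) auto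
  finally have "int n = (\<Sum>e\<in>edges T. uses D {..<n} e)" by simp
  also have "\<dots> \<le> (\<Sum>e\<in>edges T. h e)"
    using assms unfolding trail_def by (intro sum_mono) auto
  finally show ?thesis by simp
qed

text \<open>Only the two open ends of the trail are unbalanced. At the vertex where it stops, the
  remaining capacity \<open>h - uses\<close> therefore has a boundary of the sign needed to leave,
  and so some end of this sign has capacity left.\<close>

lemma trail_extends:
  assumes tr: "trail D (Suc m)" and ne: "leave (D 0) \<noteq> arrive (D m)"
  shows "\<exists>D'. trail D' (Suc (Suc m))"
proof -
  let ?p = "leave (D 0)" and ?q = "arrive (D m)"
  obtain v \<sigma> where q: "?q = (v, \<sigma>)" by (cases ?q)
  have E: "fst (D i) \<in> edges T" if "i \<le> m" for i using tr that unfolding trail_def by simp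
  have step: "arrive (D i) = leave (D (Suc i))" if "i < m" for i
    using tr that unfolding trail_def by simp
  have vV: "v \<in> verts T" using q endv_verts[OF E[of m]] unfolding arrive_def by auto
  have \<sigma>: "\<sigma> = 1 \<or> \<sigma> = -1" using q sign_cases[OF E[of m]] unfolding arrive_def by force
  have p1: "snd ?p = 1 \<or> snd ?p = -1" using sign_cases[OF E[of 0]] unfolding leave_def by force
  let ?r = "\<lambda>e. h e - uses D {..<Suc m} e"
  have r: "0 \<le> ?r e" if "e \<in> edges T" for e using tr that unfolding trail_def by simp
  have "boundary T s (uses D {..<Suc m}) v
      = (\<Sum>i<Suc m. dirac (leave (D i)) v - dirac (arrive (D i)) v)"
    using E by (intro boundary_uses) auto
  also have "\<dots> = (\<Sum>i<m. dirac (leave (D i)) v - dirac (leave (D (Suc i))) v)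
      + (dirac (leave (D m)) v - dirac ?q v)"
    using step by simp
  also have "\<dots> = dirac ?p v - dirac ?q v"
    by (subst sum_lessThan_telescope') simp
  finally have "boundary T s ?r v = \<sigma> - dirac ?p v"
    using minimal vV q unfolding minimal_flow_def integral_flow_def boundary_diff
    by (simp add: dirac_def)
  \<comment> \<open>If the trail also starts at \<open>v\<close>, it does so with sign
    \<open>-\<sigma>\<close>, since the two states differ. The value is then 2 instead of 1.\<close>
  moreover have "0 < \<sigma> * (\<sigma> - dirac ?p v)"
    using \<sigma> p1 ne q by (cases ?p) (auto simp: dirac_def)
  ultimately have "0 < \<sigma> * boundary T s ?r v" by simp
  also have "\<dots> = (\<Sum>(e, b)\<in>ends_at T v. \<sigma> * s e b * ?r e)"
    unfolding boundary_def by (simp add: sum_distrib_left case_prod_beta mult.assoc)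
  finally obtain e b where eb: "(e, b) \<in> ends_at T v" "0 < \<sigma> * s e b * ?r e"
    using sum_nonpos[of "ends_at T v" "\<lambda>(e, b). \<sigma> * s e b * ?r e"] by fastforce
  then have eE: "e \<in> edges T" and ev: "endv T e b = v" unfolding ends_at_def by auto
  have seb: "s e b = \<sigma>"
    using eb(2) r[OF eE] \<sigma> sign_cases[OF eE, of b] by (auto simp: zero_less_mult_iff)
  then have re: "0 < ?r e" using eb(2) \<sigma> by auto
  define D' where "D' = D(Suc m := (e, b))"
  have D': "D' i = D i" if "i \<le> m" for i using that unfolding D'_def by simp
  have u: "uses D' {..<Suc (Suc m)} e' = uses D {..<Suc m} e' + (if e = e' then 1 else 0)" for e'
  proof -
    have "uses D' {..<Suc m} e' = uses D {..<Suc m} e'"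
      unfolding uses_def using D' by (intro sum.cong) auto
    then show ?thesis by (simp add: uses_def D'_def)
  qed
  have "trail D' (Suc (Suc m))"
    unfolding trail_def
  proof (intro conjI allI impI ballI)
    show "fst (D' i) \<in> edges T" if "i < Suc (Suc m)" for i
      using E[of i] eE that by (cases "i = Suc m") (auto simp: D'_def)
    show "arrive (D' i) = leave (D' (Suc i))" if "Suc i < Suc (Suc m)" for i
    proof (cases "i = m")
      case True
      then show ?thesis using q seb ev by (simp add: D'_def leave_def)
    next
      case False
      then show ?thesis using step[of i] that D'[of i] D'[of "Suc i"] by simp
    qed
    show "uses D' {..<Suc (Suc m)} e' \<le> h e'" if "e' \<in> edges T" for e'
      using r[OF that] re u[of e'] by auto
  qed
  then show ?thesis by blast
qed

lemma closed_trail: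
  obtains n D where "0 < n" "\<And>i. fst (D i) \<in> edges T" "\<And>i. arrive (D i) = leave (D (Suc i))"
    "D n = D 0" "\<And>e. e \<in> edges T \<Longrightarrow> h e = uses D {..<n} e"
proof -
  let ?P = "\<lambda>n. \<exists>D. trail D n"
  obtain e0 where e0: "e0 \<in> edges T" using minimal unfolding minimal_flow_def by auto
  have "trail (\<lambda>_. (e0, False)) (Suc 0)"
    using e0 pos unfolding trail_def uses_def by force
  then have P1: "?P (Suc 0)" by blast
  define n where "n = (GREATEST n. ?P n)"
  have bounded: "\<forall>k. ?P k \<longrightarrow> k \<le> nat (\<Sum>e\<in>edges T. h e)" using trail_bounded by blast
  have Pn: "?P n" unfolding n_def by (rule GreatestI_nat[where P = ?P, OF P1]) (use bounded in blast)
  have max: "k \<le> n" if "?P k" for k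
    unfolding n_def by (rule Greatest_le_nat[where P = ?P, OF that]) (use bounded in blast)
  obtain m where m: "n = Suc m" using max[OF P1] by (cases n) auto
  obtain D where D: "trail D (Suc m)" using Pn m by auto
  have closed: "leave (D 0) = arrive (D m)"
    using trail_extends[OF D] max[of "Suc (Suc m)"] m by fastforce
  \<comment> \<open>Periodic continuation makes the step from the last traversal to the first one
    like all others.\<close>
  define C where "C i = D (i mod n)" for i
  have E: "fst (C i) \<in> edges T" for i using D m unfolding trail_def C_def by simp
  have step: "arrive (C i) = leave (C (Suc i))" for i
  proof (cases "Suc (i mod n) = n")
    case True
    then have "Suc i mod n = 0" "i mod n = m" using m by (auto simp: mod_Suc)
    then show ?thesis using closed by (simp add: C_def)
  next
    case False
    then have "Suc i mod n = Suc (i mod n)" by (simp add: mod_Suc)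
    moreover have "Suc (i mod n) < Suc m" using False m
      by (metis Suc_lessI mod_less_divisor zero_less_Suc)
    ultimately show ?thesis using D unfolding C_def trail_def by auto
  qed
  have Cn: "C n = C 0" by (simp add: C_def)
  have uC: "uses C {..<n} = uses D {..<n}"
    unfolding uses_def C_def by (intro ext sum.cong) auto
  have "boundary T s (uses C {..<n}) v = 0" for v
  proof -
    have "boundary T s (uses C {..<n}) v
        = (\<Sum>i<n. dirac (leave (C i)) v - dirac (leave (C (Suc i))) v)"
      using E step by (subst boundary_uses) auto
    also have "\<dots> = 0" by (subst sum_lessThan_telescope') (simp add: Cn)
    finally show ?thesis .
  qed
  then have fl: "integral_flow T s (uses C {..<n})" by (simp add: integral_flow_def)
  have bound: "0 \<le> uses C {..<n} e \<and> uses C {..<n} e \<le> h e" if "e \<in> edges T" for e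
  proof
    show "0 \<le> uses C {..<n} e" unfolding uses_def by (rule sum_nonneg) simp
    show "uses C {..<n} e \<le> h e" using D that unfolding uC trail_def m[symmetric] by blast
  qed
  have "uses C {..<n} (fst (C 0)) \<noteq> 0"
  proof -
    have "(\<Sum>i\<in>{0}. if fst (C i) = fst (C 0) then 1 else 0) \<le> uses C {..<n} (fst (C 0))"
      unfolding uses_def by (rule sum_mono2) (auto simp: m)
    then show ?thesis by simp
  qed
  then have "\<not> (\<forall>e\<in>edges T. uses C {..<n} e = 0)" using E[of 0] by blast
  then have "\<forall>e\<in>edges T. uses C {..<n} e = h e"
    using minimal fl bound unfolding minimal_flow_def by blast
  then have "h e = uses C {..<n} e" if "e \<in> edges T" for e using that by simp
  moreover have "0 < n" using m by simp
  ultimately show ?thesis using that[of n C] E step Cn by blast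
qed

text \<open>For both signs this turns out to be the number of visits of the closed trail to
  \<open>v\<close>.\<close>

definition weight :: "'v \<Rightarrow> int \<Rightarrow> int" where
  "weight v \<sigma> = (\<Sum>(e, b) | (e, b) \<in> ends T (edges T) v \<and> s e b = \<sigma>. h e)"

text \<open>At a vertex visited twice, the separating side is the part of the trail between the two
  visits. It leaves \<open>v\<close> through an end of sign \<open>snd (t i)\<close> and comes back
  through an end of the same sign, because the second visit has the opposite state and arrival
  reverses signs.\<close>

lemma local_structure:
  assumes v: "v \<in> verts T"
  shows "(weight v 1 = 1 \<and> weight v (-1) = 1) \<or>
    (weight v 1 = 2 \<and> weight v (-1) = 2 \<and>
     (\<exists>A. separation T (edges T) v A \<and>
        (\<forall>e\<in>edges T. \<forall>b. endv T e b = v \<longrightarrow> (e \<in> A \<longleftrightarrow> s e b = 1))))"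
proof -
  obtain n D where n: "0 < n" and E: "\<And>i. fst (D i) \<in> edges T"
    and step: "\<And>i. arrive (D i) = leave (D (Suc i))"
    and Dn: "D n = D 0" and h: "\<And>e. e \<in> edges T \<Longrightarrow> h e = uses D {..<n} e"
    by (rule closed_trail) blast
  define t where "t i = leave (D i)" for i
  have tn: "t n = t 0" using Dn by (simp add: t_def)
  have t_sign: "snd (t i) = 1 \<or> snd (t i) = -1" for i
    using sign_cases[OF E] by (auto simp: t_def leave_def)
  have t_next: "t (Suc i) = arrive (D i)" for i using step by (simp add: t_def)

  \<comment> \<open>A proper nonempty part uses some edge at least once and some edge less often
    than \<open>h\<close>, so by minimality it is no flow.\<close>
  have no_sub: False
    if I: "I \<subseteq> {..<n}" "I \<noteq> {}" "I \<noteq> {..<n}"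
      and flow: "\<And>v. (\<Sum>i\<in>I. dirac (t i) v - dirac (t (Suc i)) v) = 0" for I
  proof -
    have finI: "finite I" using I(1) by (rule finite_subset) simp
    have "integral_flow T s (uses D I)"
      using flow E by (simp add: integral_flow_def boundary_uses t_next[symmetric] t_def[symmetric])
    moreover have "0 \<le> uses D I e \<and> uses D I e \<le> h e" if "e \<in> edges T" for e
      unfolding h[OF that] uses_def using I(1) by (auto intro!: sum_nonneg sum_mono2)
    ultimately consider "\<forall>e\<in>edges T. uses D I e = 0" | "\<forall>e\<in>edges T. uses D I e = h e"
      using minimal unfolding minimal_flow_def by blast
    then show False
    proof cases
      case 1
      obtain i where i: "i \<in> I" using I(2) by auto
      have "(\<Sum>k\<in>{i}. if fst (D k) = fst (D i) then 1 else 0) \<le> uses D I (fst (D i))"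
        unfolding uses_def using i finI by (intro sum_mono2) auto
      then show False using 1 E[of i] by simp
    next
      case 2
      obtain j where j: "j < n" "j \<notin> I" using I(1,3) by auto
      have "(\<Sum>k\<in>insert j I. if fst (D k) = fst (D j) then 1 else 0) \<le> uses D {..<n} (fst (D j))"
        unfolding uses_def using j I(1) by (intro sum_mono2) auto
      moreover have "(\<Sum>k\<in>insert j I. if fst (D k) = fst (D j) then 1 else 0)
          = 1 + uses D I (fst (D j))"
        unfolding uses_def using j finI by simp
      ultimately show False using 2 E[of j] h[OF E[of j]] by simp
    qed
  qed

  have segment: "(\<Sum>k\<in>{i..<j}. dirac (t k) w - dirac (t (Suc k)) w) = dirac (t i) w - dirac (t j) w"
    if "i \<le> j" for i j w
    using sum_Suc_diff'[OF that, of "\<lambda>k. - dirac (t k) w"] by simp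

  \<comment> \<open>Between two equal states the trail would close up to a smaller flow.\<close>
  have distinct: "t i \<noteq> t j" if "i < j" "j < n" for i j
  proof
    assume eq: "t i = t j"
    show False
    proof (rule no_sub[of "{i..<j}"])
      show "{i..<j} \<noteq> {..<n}" using that by (metis atLeastLessThan_iff lessThan_iff less_irrefl)
      show "(\<Sum>k\<in>{i..<j}. dirac (t k) v - dirac (t (Suc k)) v) = 0" for v
        using segment[of i j] that eq by simp
    qed (use that in auto)
  qed

  have opposite: "snd (t i) = - snd (t j)"
    if "i < j" "j < n" "fst (t i) = fst (t j)" for i j
    using distinct[OF that(1,2)] that(3) t_sign[of i] t_sign[of j] by (auto simp: prod_eq_iff)

  \<comment> \<open>The two segments have boundaries \<open>t i - t j\<close> and
    \<open>t k - t l\<close>. Their sum vanishes, since \<open>t k\<close> is opposite to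
    \<open>t i\<close> and \<open>t l\<close> to \<open>t j\<close>.\<close>
  have noncrossing: False
    if "i < j" "j < k" "k < l" "l < n" "fst (t i) = fst (t k)" "fst (t j) = fst (t l)" for i j k l
  proof (rule no_sub[of "{i..<j} \<union> {k..<l}"])
    show "{i..<j} \<union> {k..<l} \<noteq> {..<n}"
    proof
      assume "{i..<j} \<union> {k..<l} = {..<n}"
      moreover have "j \<in> {..<n}" using that by simp
      ultimately show False using that by (metis Un_iff atLeastLessThan_iff less_irrefl not_less)
    qed
    have "{i..<j} \<inter> {k..<l} = {}" using that by auto
    then show "(\<Sum>x\<in>{i..<j} \<union> {k..<l}. dirac (t x) w - dirac (t (Suc x)) w) = 0" for w
      using segment[of i j w] segment[of k l w] opposite[of i k] opposite[of j l] that
      by (subst sum.union_disjoint) (auto simp: dirac_def)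
  qed (use that in auto)

  define J where "J = {i. i < n \<and> fst (t i) = v}"
  have finJ: "finite J" unfolding J_def by simp
  \<comment> \<open>A visit left through an end of one sign is entered through an end of the other,
    so each visit uses exactly one end of each sign.\<close>
  have weight_J: "weight v \<sigma> = int (card J)" if \<sigma>: "\<sigma> = 1 \<or> \<sigma> = -1" for \<sigma>
  proof -
    let ?X = "{(e, b). (e, b) \<in> ends T (edges T) v \<and> s e b = \<sigma>}"
    have finX: "finite ?X"
      by (rule finite_subset[OF _ finite_ends[OF fin_edges, of T v]]) auto
    have inner: "(\<Sum>(e, b)\<in>?X. if fst (D i) = e then 1 else 0)
        = (if t i = (v, \<sigma>) then 1 else 0) + (if t (Suc i) = (v, - \<sigma>) then 1 else (0::int))" for i
    proof -
      obtain e b where Di: "D i = (e, b)" by (cases "D i")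
      have eE: "e \<in> edges T" using E[of i] Di by simp
      have "(\<Sum>(e', b)\<in>?X. if e = e' then 1 else (0::int))
          = (\<Sum>p\<in>?X \<inter> {e} \<times> UNIV. 1)"
        using finX by (subst sum.inter_restrict) (auto intro!: sum.cong)
      also have "?X \<inter> {e} \<times> UNIV = Pair e ` {c. endv T e c = v \<and> s e c = \<sigma>}"
        using eE by (auto simp: ends_def)
      also have "(\<Sum>p\<in>\<dots>. 1) = (\<Sum>c\<in>{c. endv T e c = v \<and> s e c = \<sigma>}. (1::int))"
        by (subst sum.reindex) (auto simp: inj_on_def)
      also have "\<dots> = (\<Sum>c\<in>UNIV. if endv T e c = v \<and> s e c = \<sigma> then 1 else 0)"
        by (subst sum.inter_filter[symmetric]) auto
      also have "\<dots> = (if t i = (v, \<sigma>) then 1 else 0) + (if t (Suc i) = (v, - \<sigma>) then 1 else 0)"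
        using Di by (cases b) (auto simp: UNIV_bool t_next t_def[of i] leave_def arrive_def)
      finally show ?thesis using Di by simp
    qed
    have "weight v \<sigma> = (\<Sum>(e, b)\<in>?X. \<Sum>i<n. if fst (D i) = e then 1 else 0)"
      unfolding weight_def by (intro sum.cong) (auto simp: h uses_def ends_def)
    also have "\<dots> = (\<Sum>i<n. \<Sum>(e, b)\<in>?X. if fst (D i) = e then 1 else 0)"
      unfolding case_prod_beta by (rule sum.swap)
    also have "\<dots> = (\<Sum>i<n. if t i = (v, \<sigma>) then 1 else 0)
        + (\<Sum>i<n. if t (Suc i) = (v, - \<sigma>) then 1 else 0)"
      unfolding inner by (rule sum.distrib)
    \<comment> \<open>The trail is closed, so a shift of time by one does not change the
      count.\<close>
    also have "(\<Sum>i<n. if t (Suc i) = (v, - \<sigma>) then 1 else (0::int))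
        = (\<Sum>i<n. if t i = (v, - \<sigma>) then 1 else 0)"
    proof -
      let ?x = "\<lambda>i. if t i = (v, - \<sigma>) then 1 else (0::int)"
      have "(\<Sum>i<n. ?x (Suc i) - ?x i) = 0"
        by (subst sum_lessThan_telescope) (simp add: tn)
      then show ?thesis by (simp only: sum_subtractf)
    qed
    also have "(\<Sum>i<n. if t i = (v, \<sigma>) then 1 else 0) + (\<Sum>i<n. if t i = (v, - \<sigma>) then 1 else 0)
        = (\<Sum>i<n. if fst (t i) = v then 1 else (0::int))"
      unfolding sum.distrib[symmetric]
    proof (rule sum.cong[OF refl])
      fix i
      show "(if t i = (v, \<sigma>) then 1 else 0) + (if t i = (v, - \<sigma>) then 1 else 0)
          = (if fst (t i) = v then 1 else (0::int))"
        using t_sign[of i] \<sigma> by (cases "t i") auto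
    qed
    also have "\<dots> = int (card J)"
      unfolding J_def by (subst sum.inter_filter[symmetric]) auto
    finally show ?thesis .
  qed

  have visited: "\<exists>k<n. e = fst (D k)" if "e \<in> edges T" for e
  proof (rule ccontr)
    assume "\<not> ?thesis"
    then have "uses D {..<n} e = 0" unfolding uses_def by (intro sum.neutral) auto
    then show False using h[OF that] pos[OF that] by simp
  qed
  have "J \<noteq> {}"
  proof -
    obtain e b where e: "e \<in> edges T" "endv T e b = v"
      using v verts_eq unfolding cover_def inc_def by auto
    obtain k where k: "k < n" "e = fst (D k)" using visited[OF e(1)] by blast
    have "fst (t k) = v \<or> fst (t (Suc k)) = v"
      using e(2) k unfolding t_next unfolding t_def leave_def arrive_def
      by (cases "b = snd (D k)") auto
    moreover have "Suc k < n \<or> t (Suc k) = t 0" using k(1) tn by (cases "Suc k = n") auto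
    ultimately have "k \<in> J \<or> Suc k \<in> J \<or> 0 \<in> J" using k(1) n unfolding J_def by auto
    then show ?thesis by auto
  qed
  moreover have "card J \<le> 2"
  proof -
    have "inj_on t J"
    proof (rule inj_onI)
      fix i j assume "i \<in> J" "j \<in> J" "t i = t j"
      then show "i = j"
        using distinct[of i j] distinct[of j i] unfolding J_def by (cases i j rule: linorder_cases) auto
    qed
    moreover have "t ` J \<subseteq> {(v, 1), (v, -1)}"
      using t_sign unfolding J_def by (force simp: prod_eq_iff)
    ultimately have "card J \<le> card {(v, 1::int), (v, -1)}"
      by (intro card_inj_on_le) auto
    then show ?thesis by simp
  qed
  ultimately consider "card J = 1" | "card J = 2"
    using finJ by (cases "card J"; cases "card J - 1") auto
  then show ?thesis
  proof cases
    case 1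
    then show ?thesis using weight_J by simp
  next
    case 2
    then obtain i0 j0 where "J = {i0, j0}" "i0 \<noteq> j0" by (auto simp: card_2_iff)
    define i j where "i = min i0 j0" and "j = max i0 j0"
    have ij: "i < j" "j < n" "fst (t i) = v" "fst (t j) = v" and Jij: "J = {i, j}"
      using \<open>J = {i0, j0}\<close> \<open>i0 \<noteq> j0\<close> unfolding i_def j_def J_def min_def max_def by auto
    have only: "k = i \<or> k = j" if "k < n" "fst (t k) = v" for k
      using that Jij unfolding J_def by blast
    define A where "A = (fst \<circ> D) ` {i..<j}"
    have side_A: "s e b = snd (t i)" if "e \<in> A" "endv T e b = v" for e b
    proof -
      obtain k where k: "i \<le> k" "k < j" "e = fst (D k)" using \<open>e \<in> A\<close> unfolding A_def by auto
      show ?thesis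
      proof (cases "b = snd (D k)")
        case True
        then have "t k = (v, s e b)" using k that by (simp add: t_def leave_def)
        moreover have "k = i" using only[of k] k ij calculation by auto
        ultimately show ?thesis by simp
      next
        case False
        then have b: "b = (\<not> snd (D k))" by auto
        then have "t (Suc k) = (v, - s e b)" using k that by (simp add: t_next arrive_def)
        moreover have "Suc k = j" using only[of "Suc k"] k ij calculation by auto
        ultimately show ?thesis using opposite[of i j] ij by simp
      qed
    qed
    have other: "\<exists>k<n. (k < i \<or> j \<le> k) \<and> e = fst (D k)" if "e \<in> edges T - A" for e
      using visited[of e] that unfolding A_def by force
    have side_B: "s e b = - snd (t i)"
      if "k < n" "k < i \<or> j \<le> k" "e = fst (D k)" "endv T e b = v" for e b k
    proof (cases "b = snd (D k)")
      case True
      then have "t k = (v, s e b)" using that by (simp add: t_def leave_def)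
      moreover have "k = j" using only[of k] that ij calculation by auto
      ultimately show ?thesis using opposite[of i j] ij by simp
    next
      case False
      then have b: "b = (\<not> snd (D k))" by auto
      then have tk: "t (Suc k) = (v, - s e b)" using that by (simp add: t_next arrive_def)
      \<comment> \<open>Outside the segment, \<open>v\<close> can only be entered at time
        \<open>i\<close>, possibly by wrapping around from \<open>n\<close> to 0.\<close>
      have "t (Suc k) = t i"
      proof (cases "Suc k = n")
        case True
        then have "fst (t 0) = v" using tk tn by simp
        then have "i = 0" using only[of 0] n ij by auto
        then show ?thesis using True tn by simp
      next
        case False
        then have "Suc k = i \<or> Suc k = j" using only[of "Suc k"] that tk by auto
        then show ?thesis using that ij by auto
      qed
      then have "snd (t i) = - s e b" using tk by (metis snd_conv)
      then show ?thesis by simp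
    qed
    have vertex_A: "\<exists>k. i \<le> k \<and> k \<le> j \<and> fst (t k) = w" if "e \<in> A" "inc T e w" for e w
    proof -
      obtain k where k: "i \<le> k" "k < j" "e = fst (D k)" using \<open>e \<in> A\<close> unfolding A_def by auto
      obtain b where b: "endv T e b = w" using \<open>inc T e w\<close> unfolding inc_def by auto
      then have "fst (t k) = w \<or> fst (t (Suc k)) = w"
        using k(3) unfolding t_next unfolding t_def leave_def arrive_def
        by (cases "b = snd (D k)") auto
      then show ?thesis using k by (metis Suc_leI le_SucI less_imp_le_nat)
    qed
    have vertex_B: "\<exists>k<n. (k \<le> i \<or> j \<le> k) \<and> fst (t k) = w"
      if e: "e \<in> edges T - A" "inc T e w" for e w
    proof -
      obtain k where k: "k < n" "k < i \<or> j \<le> k" "e = fst (D k)" using other[OF e(1)] by blast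
      obtain b where b: "endv T e b = w" using \<open>inc T e w\<close> unfolding inc_def by auto
      then consider "fst (t k) = w" | "fst (t (Suc k)) = w"
        using k(3) unfolding t_next unfolding t_def leave_def arrive_def
        by (cases "b = snd (D k)") auto
      then show ?thesis
      proof cases
        case 1
        then show ?thesis using k by (auto intro: less_imp_le)
      next
        case 2
        then show ?thesis
        proof (cases "Suc k = n")
          case True
          then show ?thesis using 2 tn n by (intro exI[of _ 0]) simp
        next
          case False
          then show ?thesis using 2 k by (intro exI[of _ "Suc k"]) auto
        qed
      qed
    qed
    have sep: "separation T (edges T) v A"
      unfolding separation_def
    proof (intro conjI ballI allI impI)
      show "A \<subseteq> edges T" using E unfolding A_def by auto
      show "A \<noteq> {}" using ij unfolding A_def by auto
      have "s (fst (D j)) (snd (D j)) = - snd (t i)"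
        using side_B[of j] ij by (simp add: t_def leave_def)
      moreover have "endv T (fst (D j)) (snd (D j)) = v" using ij by (simp add: t_def leave_def)
      ultimately have "fst (D j) \<notin> A" using side_A t_sign[of i] by force
      then show "A \<noteq> edges T" using E by auto
      fix a c w assume a: "a \<in> A" "inc T a w" and c: "c \<in> edges T - A" "inc T c w"
      obtain k where k: "i \<le> k" "k \<le> j" "fst (t k) = w" using vertex_A[OF a] by blast
      obtain l where l: "l < n" "l \<le> i \<or> j \<le> l" "fst (t l) = w" using vertex_B[OF c] by blast
      \<comment> \<open>Otherwise \<open>w\<close> is visited strictly inside and strictly outside
        the segment, and its visits interlace with those of \<open>v\<close>.\<close>
      show "w = v"
      proof (rule ccontr)
        assume "w \<noteq> v"
        then have "i \<noteq> k" "k \<noteq> j" "l \<noteq> i" "l \<noteq> j" using k l ij by auto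
        then have "i < k" "k < j" "l < i \<or> j < l" using k l by auto
        then show False
          using noncrossing[of l i k j] noncrossing[of i k j l] ij k l by auto
      qed
    qed
    have darts: "e \<in> A \<longleftrightarrow> s e b = snd (t i)" if "e \<in> edges T" "endv T e b = v" for e b
    proof (cases "e \<in> A")
      case True
      then show ?thesis using side_A that by simp
    next
      case False
      then obtain k where "k < n" "k < i \<or> j \<le> k" "e = fst (D k)" using other[of e] \<open>e \<in> edges T\<close> by blast
      then show ?thesis using side_B that False t_sign[of i] by force
    qed
    have "\<exists>A. separation T (edges T) v A \<and>
        (\<forall>e\<in>edges T. \<forall>b. endv T e b = v \<longrightarrow> (e \<in> A \<longleftrightarrow> s e b = 1))"
    proof (cases "snd (t i) = 1")
      case True
      then show ?thesis using sep darts by (intro exI[of _ A]) auto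
    next
      case False
      then have "snd (t i) = -1" using t_sign[of i] by auto
      then have "e \<in> edges T - A \<longleftrightarrow> s e b = 1" if "e \<in> edges T" "endv T e b = v" for e b
        using darts[OF that] that(1) sign_cases[OF that(1), of b] by auto
      then show ?thesis using separation_compl[OF sep] by blast
    qed
    then show ?thesis using weight_J 2 by simp
  qed
qed

end

section \<open>The blocks of a minimal flow\<close>

lemma sum_eq_1_int:
  fixes \<phi> :: "'a \<Rightarrow> int"
  assumes "finite X" "\<And>x. x \<in> X \<Longrightarrow> 1 \<le> \<phi> x" "sum \<phi> X = 1"
  obtains x where "X = {x}" "\<phi> x = 1"
proof -
  have "of_nat (card X) * 1 \<le> sum \<phi> X" using assms(2) by (rule sum_bounded_below)
  then have "card X \<le> 1" "X \<noteq> {}" using assms(3) by auto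
  then obtain x where "X = {x}"
    using assms(1) by (metis card_1_singletonE card_0_eq le_antisym less_one not_less)
  then show ?thesis using that assms(3) by simp
qed

lemma sum_eq_2_int:
  fixes \<phi> :: "'a \<Rightarrow> int"
  assumes "finite X" "\<And>x. x \<in> X \<Longrightarrow> 1 \<le> \<phi> x" "sum \<phi> X = 2"
  shows "(\<exists>x. X = {x} \<and> \<phi> x = 2) \<or> (\<exists>x y. x \<noteq> y \<and> X = {x, y} \<and> \<phi> x = 1 \<and> \<phi> y = 1)"
proof -
  obtain x where x: "x \<in> X" using assms(3) by fastforce
  have sx: "\<phi> x + sum \<phi> (X - {x}) = 2" using sum.remove[OF assms(1) x, of \<phi>] assms(3) by simp
  show ?thesis
  proof (cases "X - {x} = {}")
    case True
    then have "X = {x}" using x by auto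
    then show ?thesis using assms(3) by simp
  next
    case False
    have "of_nat (card (X - {x})) * 1 \<le> sum \<phi> (X - {x})"
      using assms(2) by (intro sum_bounded_below) auto
    moreover have "0 < card (X - {x})" using False assms(1) by (simp add: card_gt_0_iff)
    ultimately have s1: "sum \<phi> (X - {x}) = 1" and p1: "\<phi> x = 1"
      using sx assms(2)[OF x] by linarith+
    have ge: "1 \<le> \<phi> z" if "z \<in> X - {x}" for z using assms(2) that by blast
    obtain y where "X - {x} = {y}" "\<phi> y = 1"
      by (rule sum_eq_1_int[OF finite_Diff[OF assms(1)] ge s1])
    then have "x \<noteq> y" "X = {x, y}" using x by auto
    then show ?thesis using p1 \<open>\<phi> y = 1\<close> by blast
  qed
qed

context minimal_flow_graph
begin

text \<open>The restriction of \<open>h\<close> to a part that is vertex-disjoint from the rest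
  would be a smaller flow.\<close>

lemma linked_edges: "linked T (edges T)"
  unfolding linked_def
proof (intro conjI allI impI)
  show "edges T \<noteq> {}" using minimal unfolding minimal_flow_def by simp
  fix A assume A: "A \<subseteq> edges T" "A \<noteq> {}" "A \<noteq> edges T"
  show "\<exists>a\<in>A. \<exists>c\<in>edges T - A. \<exists>w. inc T a w \<and> inc T c w"
  proof (rule ccontr)
    assume no: "\<not> ?thesis"
    define g where "g = (\<lambda>e. if e \<in> A then h e else 0)"
    have "boundary T s g v = 0" if v: "v \<in> verts T" for v
    proof (cases "\<exists>a\<in>A. inc T a v")
      case True
      have "boundary T s g v = boundary T s h v"
        unfolding boundary_def
      proof (rule sum.cong[OF refl], clarify)
        fix e b assume "(e, b) \<in> ends_at T v"
        then have "e \<in> edges T" "inc T e v" unfolding ends_at_def by auto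
        then have "e \<in> A" using no True by blast
        then show "s e b * g e = s e b * h e" by (simp add: g_def)
      qed
      then show ?thesis using minimal v unfolding minimal_flow_def integral_flow_def by simp
    next
      case False
      then show ?thesis unfolding boundary_def ends_at_def
        by (intro sum.neutral) (auto simp: g_def inc_def)
    qed
    then have "integral_flow T s g" by (simp add: integral_flow_def)
    moreover have "\<forall>e\<in>edges T. 0 \<le> g e \<and> g e \<le> h e"
      using pos by (auto simp: g_def intro: less_imp_le)
    ultimately consider "\<forall>e\<in>edges T. g e = 0" | "\<forall>e\<in>edges T. g e = h e"
      using minimal unfolding minimal_flow_def by blast
    then show False
    proof cases
      case 1
      obtain a where "a \<in> A" "a \<in> edges T" using A by auto
      then show False using 1 pos[of a] by (auto simp: g_def)
    next
      case 2
      obtain c where "c \<in> edges T" "c \<notin> A" using A by auto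
      then show False using 2 pos[of c] by (auto simp: g_def)
    qed
  qed
qed

text \<open>The vertices that the closed trail visits twice; they turn out to be the cut-vertices.\<close>

definition double :: "'v \<Rightarrow> bool" where
  "double v \<longleftrightarrow> weight v 1 = 2"

text \<open>The blocks arise by splitting each double vertex into its positive and its negative half.\<close>

definition link :: "('e \<times> 'e) set" where
  "link = {(e, e'). e \<in> edges T \<and> e' \<in> edges T \<and>
     (\<exists>b b'. endv T e b = endv T e' b' \<and> (\<not> double (endv T e b) \<or> s e b = s e' b'))}"

definition cls :: "'e \<Rightarrow> 'e set" where
  "cls e = link\<^sup>* `` {e}"

section \<open>Classes of linked edges\<close>

lemma weight_double: "v \<in> verts T \<Longrightarrow> \<sigma> = 1 \<or> \<sigma> = -1 \<Longrightarrow> weight v \<sigma> = (if double v then 2 else 1)"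
  using local_structure unfolding double_def by fastforce

lemma double_separation:
  assumes "v \<in> verts T" "double v"
  obtains A where "separation T (edges T) v A"
    "\<And>e b. e \<in> edges T \<Longrightarrow> endv T e b = v \<Longrightarrow> e \<in> A \<longleftrightarrow> s e b = 1"
  using local_structure[OF assms(1)] assms(2) unfolding double_def by auto

lemma link_sym: "sym link"
  unfolding sym_def link_def by (auto; metis)

lemma cls_self [simp]: "e \<in> cls e"
  unfolding cls_def by simp

lemma cover_cls: "inc T e v \<Longrightarrow> v \<in> cover T (cls e)"
  by (rule coverI[OF cls_self])

lemma cls_link: "a \<in> cls e \<Longrightarrow> (a, c) \<in> link \<Longrightarrow> c \<in> cls e"
  unfolding cls_def by auto

lemma cls_eq:
  assumes "a \<in> cls e"
  shows "cls a = cls e"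
proof -
  have "(e, a) \<in> link\<^sup>*" using assms unfolding cls_def by simp
  moreover have "(a, e) \<in> link\<^sup>*" using calculation sym_rtrancl[OF link_sym] by (meson symE)
  ultimately show ?thesis unfolding cls_def by (auto intro: rtrancl_trans)
qed

lemma cls_induct:
  assumes "a \<in> cls e" "P e" "\<And>x y. x \<in> cls e \<Longrightarrow> (x, y) \<in> link \<Longrightarrow> P x \<Longrightarrow> P y"
  shows "P a"
proof -
  have "(e, a) \<in> link\<^sup>*" using assms(1) unfolding cls_def by simp
  then have "a \<in> cls e \<and> P a"
    by (induction rule: rtrancl_induct) (use assms(2,3) cls_link in \<open>auto\<close>)
  then show ?thesis ..
qed

lemma cls_edges:
  assumes "e \<in> edges T"
  shows "cls e \<subseteq> edges T"
proof
  fix a assume "a \<in> cls e"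
  then show "a \<in> edges T" by (rule cls_induct) (use assms in \<open>auto simp: link_def\<close>)
qed

lemma linked_cls: "linked T (cls e)"
  unfolding linked_def
proof (intro conjI allI impI)
  show "cls e \<noteq> {}" using cls_self by blast
  fix A assume A: "A \<subseteq> cls e" "A \<noteq> {}" "A \<noteq> cls e"
  show "\<exists>a\<in>A. \<exists>c\<in>cls e - A. \<exists>w. inc T a w \<and> inc T c w"
  proof (rule ccontr)
    assume no: "\<not> ?thesis"
    have step: "x \<in> A \<longleftrightarrow> y \<in> A" if xy: "x \<in> cls e" "(x, y) \<in> link" for x y
    proof -
      obtain b b' where "endv T x b = endv T y b'" using xy(2) unfolding link_def by auto
      then have "inc T x (endv T x b)" "inc T y (endv T x b)" by (metis inc_endv)+
      then show ?thesis using no xy cls_link[OF xy] by blast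
    qed
    have "a \<in> A \<longleftrightarrow> e \<in> A" if "a \<in> cls e" for a
      using that by (rule cls_induct) (use step in auto)
    then show False using A by blast
  qed
qed

text \<open>No link crosses the separation. Away from \<open>v\<close> this is the defining property
  of a separation; at \<open>v\<close> linked ends have the same sign, and the sign decides the
  side.\<close>

lemma cls_side:
  assumes "v \<in> verts T" "double v" "separation T (edges T) v A"
    "\<And>e b. e \<in> edges T \<Longrightarrow> endv T e b = v \<Longrightarrow> e \<in> A \<longleftrightarrow> s e b = 1"
    and a: "a \<in> cls e"
  shows "a \<in> A \<longleftrightarrow> e \<in> A"
  using a
proof (rule cls_induct)
  fix x y assume "(x, y) \<in> link" and IH: "(x \<in> A) = (e \<in> A)"
  then obtain b b' where xy: "x \<in> edges T" "y \<in> edges T" "endv T x b = endv T y b'"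
    "\<not> double (endv T x b) \<or> s x b = s y b'" unfolding link_def by blast
  have "x \<in> A \<longleftrightarrow> y \<in> A"
  proof (cases "endv T x b = v")
    case True
    then show ?thesis using assms(2) assms(4)[of x b] assms(4)[of y b'] xy by auto
  next
    case False
    have "inc T y (endv T x b)" using xy(3) by simp
    then show ?thesis using separationD[OF assms(3) xy(1,2) inc_endv _ False] by simp
  qed
  then show "(y \<in> A) = (e \<in> A)" using IH by simp
qed simp

definition half :: "'v \<Rightarrow> int \<Rightarrow> ('e \<times> bool) set" where
  "half v \<sigma> = {(e, b). (e, b) \<in> ends T (edges T) v \<and> s e b = \<sigma>}"

lemma finite_half: "finite (half v \<sigma>)"
  by (rule finite_subset[OF _ finite_ends[OF fin_edges, of T v]]) (auto simp: half_def)

lemma half_sign: "(e, b) \<in> half v \<sigma> \<Longrightarrow> s e b = \<sigma>"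
  by (simp add: half_def)

lemma half_simple:
  assumes "v \<in> verts T" "\<not> double v" "\<sigma> = 1 \<or> \<sigma> = -1"
  obtains e b where "half v \<sigma> = {(e, b)}" "h e = 1"
proof -
  have "sum (\<lambda>(e, b). h e) (half v \<sigma>) = 1"
    using weight_double[OF assms(1,3)] assms(2) unfolding weight_def half_def by simp
  moreover have "1 \<le> (case x of (e, b) \<Rightarrow> h e)" if "x \<in> half v \<sigma>" for x
    using that pos unfolding half_def ends_def by force
  ultimately obtain x where "half v \<sigma> = {x}" "(case x of (e, b) \<Rightarrow> h e) = 1"
    using sum_eq_1_int[OF finite_half] by metis
  then show ?thesis using that by (cases x) auto
qed

lemma half_double:
  assumes "v \<in> verts T" "double v" "\<sigma> = 1 \<or> \<sigma> = -1"
  obtains e b where "half v \<sigma> = {(e, b)}" "h e = 2"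
    | e b e' b' where "half v \<sigma> = {(e, b), (e', b')}" "(e, b) \<noteq> (e', b')" "h e = 1" "h e' = 1"
proof -
  have *: "sum (\<lambda>(e, b). h e) (half v \<sigma>) = 2"
    using weight_double[OF assms(1,3)] assms(2) unfolding weight_def half_def by simp
  have ge: "1 \<le> (case x of (e, b) \<Rightarrow> h e)" if "x \<in> half v \<sigma>" for x
    using that pos unfolding half_def ends_def by force
  consider x where "half v \<sigma> = {x}" "(case x of (e, b) \<Rightarrow> h e) = 2"
    | x y where "x \<noteq> y" "half v \<sigma> = {x, y}"
      "(case x of (e, b) \<Rightarrow> h e) = 1" "(case y of (e, b) \<Rightarrow> h e) = 1"
    using sum_eq_2_int[OF finite_half ge *] by blast
  then show ?thesis
  proof cases
    case (1 x)
    then show ?thesis using that(1) by (cases x) simp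
  next
    case (2 x y)
    then show ?thesis using that(2) by (cases x; cases y) simp
  qed
qed

lemma ends_halves: "ends T (edges T) v = half v 1 \<union> half v (-1)"
  using sign_cases unfolding half_def ends_def by auto

text \<open>The ends with the sign of \<open>(a, b)\<close> are in the class by the definition of
  \<open>link\<close>. That the class does not come back to a double vertex through its other half
  is due to the separation at that vertex.\<close>

lemma ends_cls:
  assumes e: "e \<in> edges T" and a: "a \<in> cls e" "endv T a b = v"
  shows "ends T (cls e) v = (if double v then half v (s a b) else ends T (edges T) v)"
proof -
  have aE: "a \<in> edges T" using a cls_edges[OF e] by auto
  have sub: "(c, d) \<in> ends T (cls e) v"
    if "c \<in> edges T" "endv T c d = v" "\<not> double v \<or> s a b = s c d" for c d
  proof -
    have "endv T a b = endv T c d \<and> (\<not> double (endv T a b) \<or> s a b = s c d)"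
      using that a(2) by simp
    then have "(a, c) \<in> link" unfolding link_def using that(1) aE by blast
    then show ?thesis using cls_link[OF a(1)] that unfolding ends_def by simp
  qed
  show ?thesis
  proof (cases "double v")
    case False
    then show ?thesis using sub cls_edges[OF e] unfolding ends_def by auto
  next
    case True
    have v: "v \<in> verts T" using a aE endv_verts by auto
    obtain A where A: "separation T (edges T) v A"
      "\<And>e b. e \<in> edges T \<Longrightarrow> endv T e b = v \<Longrightarrow> e \<in> A \<longleftrightarrow> s e b = 1"
      using double_separation[OF v True] by blast
    have "s c d = s a b" if "(c, d) \<in> ends T (cls e) v" for c d
    proof -
      have c: "c \<in> cls e" "endv T c d = v" "c \<in> edges T"
        using that cls_edges[OF e] unfolding ends_def by auto
      then have "c \<in> A \<longleftrightarrow> a \<in> A" using cls_side[OF v True A] a(1) by blast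
      then show ?thesis
        using A(2)[of c d] A(2)[of a b] c a(2) aE sign_cases[of c d] sign_cases[of a b] by auto
    qed
    then show ?thesis
      using True sub cls_edges[OF e] unfolding half_def by (auto simp: ends_def)
  qed
qed

text \<open>At a double vertex the class owns one half, of weight 2: two ends of value 1 and equal
  sign, or a single end of value 2. At any other vertex it owns both halves, of weight 1 each. In
  the case \<open>two\<close>, the edges \<open>a\<close> and \<open>c\<close> may be the same
  loop.\<close>

lemma ends_cls_cases:
  assumes e: "e \<in> edges T" and v: "v \<in> cover T (cls e)"
  obtains (two) a b c d where "ends T (cls e) v = {(a, b), (c, d)}" "(a, b) \<noteq> (c, d)"
      "h a = 1" "h c = 1" "s c d = (if double v then s a b else - s a b)"
    | (one) a b where "ends T (cls e) v = {(a, b)}" "h a = 2" "double v"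
proof -
  obtain a where a: "a \<in> cls e" "inc T a v" using v by (rule coverE)
  then obtain b where b: "endv T a b = v" unfolding inc_def by auto
  have aE: "a \<in> edges T" using a cls_edges[OF e] by auto
  have vV: "v \<in> verts T" using b endv_verts[OF aE] by auto
  have eq: "ends T (cls e) v = (if double v then half v (s a b) else ends T (edges T) v)"
    by (rule ends_cls[OF e a(1) b])
  show ?thesis
  proof (cases "double v")
    case False
    obtain a1 b1 where 1: "half v 1 = {(a1, b1)}" "h a1 = 1"
      using half_simple[OF vV False, of 1] by auto
    obtain a2 b2 where 2: "half v (-1) = {(a2, b2)}" "h a2 = 1"
      using half_simple[OF vV False, of "-1"] by auto
    have "s a1 b1 = 1" "s a2 b2 = -1"
      using half_sign[of a1 b1 v 1] half_sign[of a2 b2 v "-1"] 1(1) 2(1) by simp_all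
    moreover have "ends T (cls e) v = {(a1, b1), (a2, b2)}"
      using eq False ends_halves[of v] 1(1) 2(1) by (simp add: insert_commute)
    moreover have "(a1, b1) \<noteq> (a2, b2)"
    proof
      assume "(a1, b1) = (a2, b2)"
      then have "s a1 b1 = s a2 b2" by simp
      then show False using calculation(1,2) by simp
    qed
    ultimately show ?thesis using two[of a1 b1 a2 b2] 1(2) 2(2) False by simp
  next
    case True
    have sg: "s a b = 1 \<or> s a b = -1" by (rule sign_cases[OF aE])
    from half_double[OF vV True sg] show ?thesis
    proof cases
      case (1 a1 b1)
      then show ?thesis using one[of a1 b1] eq True by simp
    next
      case (2 a1 b1 a2 b2)
      then have "s a1 b1 = s a b" "s a2 b2 = s a b"
        using half_sign[of a1 b1 v "s a b"] half_sign[of a2 b2 v "s a b"] by simp_all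
      then show ?thesis using two[of a1 b1 a2 b2] 2 eq True by simp
    qed
  qed
qed

text \<open>An end of value 2 fills its half of a double vertex, so such an edge is linked to itself
  only. The value 1 is passed on along links.\<close>

lemma h_cls_cases:
  assumes e: "e \<in> edges T"
  shows "(h e = 2 \<and> cls e = {e}) \<or> (h e = 1 \<and> (\<forall>a\<in>cls e. h a = 1))"
proof -
  have local: "(h x = 2 \<and> y = x) \<or> (h x = 1 \<and> h y = 1)"
    if xy: "x \<in> cls e" "y \<in> cls e" "inc T x v" "inc T y v" for x y v
  proof -
    obtain b b' where b: "(x, b) \<in> ends T (cls e) v" "(y, b') \<in> ends T (cls e) v"
      using ends_incE xy by metis
    have "v \<in> cover T (cls e)" using xy by (auto intro: coverI)
    from e this show ?thesis
    proof (cases rule: ends_cls_cases)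
      case (two a b'' c d)
      then have "x = a \<or> x = c" "y = a \<or> y = c" using b unfolding two(1) by blast+
      then show ?thesis using two(3,4) by blast
    next
      case (one a b'')
      then have "x = a" "y = a" using b unfolding one(1) by blast+
      then show ?thesis using one(2) by blast
    qed
  qed
  have link_inc: "\<exists>v. inc T x v \<and> inc T y v" if "(x, y) \<in> link" for x y
    using that unfolding link_def by clarsimp (metis inc_endv)
  have "h e = 1 \<or> h e = 2" using local[of e e "endv T e False"] by auto
  then show ?thesis
  proof
    assume h: "h e = 1"
    have "h a = 1" if "a \<in> cls e" for a
      using that
    proof (rule cls_induct)
      fix x y assume xy: "x \<in> cls e" "(x, y) \<in> link" "h x = 1"
      then show "h y = 1" using local[OF xy(1) cls_link[OF xy(1,2)]] link_inc[OF xy(2)] by force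
    qed (rule h)
    then show ?thesis using h by blast
  next
    assume h: "h e = 2"
    have "a = e" if "a \<in> cls e" for a
      using that
    proof (rule cls_induct)
      fix x y assume xy: "x \<in> cls e" "(x, y) \<in> link" "x = e"
      then show "y = e" using local[OF xy(1) cls_link[OF xy(1,2)]] link_inc[OF xy(2)] h by force
    qed (rule refl)
    then show ?thesis using h by auto
  qed
qed

lemma card_ends_cls:
  assumes "e \<in> edges T" "h e = 1" "v \<in> cover T (cls e)"
  shows "card (ends T (cls e) v) = 2"
  using assms(1,3)
proof (cases rule: ends_cls_cases)
  case (one a b)
  then have "a \<in> cls e" unfolding ends_def by auto
  then show ?thesis using h_cls_cases[OF assms(1)] assms(2) one(2) by auto
qed auto

lemma nonseparable_cls:
  assumes "e \<in> edges T"
  shows "nonseparable T (cls e)"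
  using h_cls_cases[OF assms]
proof
  assume "h e = 2 \<and> cls e = {e}"
  then show ?thesis using nonseparable_singleton[of T e] by simp
next
  assume "h e = 1 \<and> (\<forall>a\<in>cls e. h a = 1)"
  then show ?thesis
    using two_regular_nonseparable[OF finite_sub[OF cls_edges[OF assms]] linked_cls]
      card_ends_cls[OF assms] by blast
qed

lemma circle_cls:
  assumes "e \<in> edges T"
  shows "circle (span T (cls e)) \<longleftrightarrow> h e = 1"
proof
  assume c: "circle (span T (cls e))"
  show "h e = 1"
  proof (rule ccontr)
    assume "h e \<noteq> 1"
    then have h: "h e = 2" "cls e = {e}" using h_cls_cases[OF assms] by auto
    have v: "endv T e False \<in> cover T (cls e)" by simp
    from assms this show False
    proof (cases rule: ends_cls_cases)
      case (two a b c d)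
      then have "a \<in> cls e" unfolding ends_def by auto
      then show False using h two(3) by simp
    next
      case (one a b)
      have "card (ends T (cls e) (endv T e False)) = 2" using c v unfolding circle_span by blast
      then show False using one(1) by simp
    qed
  qed
next
  assume "h e = 1"
  then show "circle (span T (cls e))"
    using card_ends_cls[OF assms] linked_cls by (simp add: circle_span)
qed

text \<open>\<open>cls_side\<close> puts the whole class on one side of the separation at
  \<open>w\<close>, and \<open>B\<close> is the other side. An edge at \<open>w\<close> on the side
  of the class has the sign of the class there, hence belongs to it.\<close>

lemma side_at:
  assumes e: "e \<in> edges T" and w: "w \<in> cover T (cls e)"
  shows "if double w
    then \<exists>B. separation T (edges T) w B \<and> cls e \<inter> B = {} \<and>
      (\<forall>c\<in>edges T. inc T c w \<longrightarrow> c \<in> B \<or> c \<in> cls e)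
    else \<forall>c\<in>edges T. inc T c w \<longrightarrow> c \<in> cls e"
proof -
  obtain a where a: "a \<in> cls e" "inc T a w" using w by (rule coverE)
  then obtain b where b: "endv T a b = w" unfolding inc_def by auto
  have aE: "a \<in> edges T" using a cls_edges[OF e] by auto
  have vV: "w \<in> verts T" using b endv_verts[OF aE] by auto
  note eq = ends_cls[OF e a(1) b]
  show ?thesis
  proof (cases "double w")
    case False
    then have "ends T (cls e) w = ends T (edges T) w" using eq by simp
    then show ?thesis using False unfolding ends_def inc_def by auto
  next
    case True
    obtain A where A: "separation T (edges T) w A"
      "\<And>e b. e \<in> edges T \<Longrightarrow> endv T e b = w \<Longrightarrow> e \<in> A \<longleftrightarrow> s e b = 1"
      using double_separation[OF vV True] by blast
    define B where "B = (if e \<in> A then edges T - A else A)"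
    have "separation T (edges T) w B" using A(1) separation_compl unfolding B_def by auto
    moreover have side: "c \<in> A \<longleftrightarrow> e \<in> A" if "c \<in> cls e" for c
      by (rule cls_side[OF vV True A that])
    have "(c \<in> A) \<noteq> (e \<in> A)" if "c \<in> B" for c
      using that unfolding B_def by (auto split: if_splits)
    then have "cls e \<inter> B = {}" using side by blast
    moreover have "c \<in> B \<or> c \<in> cls e" if c: "c \<in> edges T" "inc T c w" for c
    proof (cases "c \<in> A \<longleftrightarrow> e \<in> A")
      case False
      then show ?thesis using c unfolding B_def by auto
    next
      case same: True
      obtain d where d: "endv T c d = w" using c(2) unfolding inc_def by auto
      then have "s c d = s a b"
        using A(2)[OF c(1) d] A(2)[OF aE b] side[OF a(1)] same
          sign_cases[OF c(1), of d] sign_cases[OF aE, of b] by auto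
      then have "(c, d) \<in> half w (s a b)" using c d unfolding half_def ends_def by simp
      then have "(c, d) \<in> ends T (cls e) w" using eq True by simp
      then show ?thesis unfolding ends_def by simp
    qed
    ultimately show ?thesis using True by auto
  qed
qed

text \<open>Every edge outside the class of \<open>e\<close> lies beyond a double vertex of the class.\<close>

lemma nonseparable_sub_cls:
  assumes D: "D \<subseteq> edges T" "nonseparable T D" and e: "e \<in> D"
  shows "D \<subseteq> cls e"
proof
  fix d assume d: "d \<in> D"
  have eE: "e \<in> edges T" using D e by auto
  define far where "far x B \<longleftrightarrow> separation T (edges T) x B \<and> cls e \<inter> B = {} \<and>
    (\<forall>c\<in>edges T. inc T c x \<longrightarrow> c \<in> B \<or> c \<in> cls e)" for x B
  \<comment> \<open>An edge that meets \<open>A\<close> either meets the class or stays beyond the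
    same vertex, so \<open>A\<close> is closed under incidence.\<close>
  define A where "A = {c \<in> edges T. c \<in> cls e \<or> (\<exists>x B. far x B \<and> c \<in> B)}"
  have "A = edges T"
  proof (rule ccontr)
    assume ne: "A \<noteq> edges T"
    have "A \<subseteq> edges T" "A \<noteq> {}" using eE cls_self unfolding A_def by blast+
    then obtain a c w where acw: "a \<in> A" "c \<in> edges T" "c \<notin> A" "inc T a w" "inc T c w"
      using ne by (rule linkedD[OF linked_edges])
    have aE: "a \<in> edges T" using acw(1) unfolding A_def by simp
    show False
    proof (cases "a \<in> cls e")
      case True
      then have "w \<in> cover T (cls e)" using acw(4) by (rule coverI)
      then have "c \<in> cls e \<or> (\<exists>B. far w B \<and> c \<in> B)"
        using side_at[OF eE, of w] acw(2,5) unfolding far_def by (auto split: if_splits)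
      then show False using acw unfolding A_def by blast
    next
      case False
      then obtain x B where B: "far x B" "a \<in> B" using acw(1) unfolding A_def by blast
      have "c \<in> B \<or> c \<in> cls e"
      proof (cases "w = x")
        case True
        then show ?thesis using B acw unfolding far_def by blast
      next
        case False
        then show ?thesis using separationD[of T "edges T" x B a c w] B acw aE unfolding far_def by blast
      qed
      then show False using B acw unfolding A_def by blast
    qed
  qed
  then have "d \<in> A" using d D(1) by auto
  then consider "d \<in> cls e" | x B where "far x B" "d \<in> B" unfolding A_def by blast
  then show "d \<in> cls e"
  proof cases
    case 2
    then have "D \<subseteq> B \<or> D \<inter> B = {}"
      using nonseparable_side[OF D(2) _ D(1)] unfolding far_def by blast
    moreover have "e \<notin> B" using 2(1) cls_self[of e] unfolding far_def by blast
    ultimately show ?thesis using 2(2) d e by blast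
  qed
qed

section \<open>Classes are the blocks, double vertices the cut-vertices\<close>

lemma edge_block_cls_iff: "edge_block T F \<longleftrightarrow> (\<exists>e\<in>edges T. F = cls e)"
proof
  assume F: "edge_block T F"
  then obtain e where e: "e \<in> F" "F \<subseteq> edges T" "nonseparable T F"
    unfolding edge_block_def nonseparable_def by blast
  then have eE: "e \<in> edges T" by auto
  have "F \<subseteq> cls e" using nonseparable_sub_cls e by blast
  then have "cls e = F"
    using F nonseparable_cls[OF eE] cls_edges[OF eE] unfolding edge_block_def by blast
  then show "\<exists>e\<in>edges T. F = cls e" using eE by blast
next
  assume "\<exists>e\<in>edges T. F = cls e"
  then obtain e where e: "e \<in> edges T" "F = cls e" by blast
  have "F' = F" if "F' \<subseteq> edges T" "nonseparable T F'" "F \<subseteq> F'" for F'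
  proof -
    have "e \<in> F'" using that(3) e(2) cls_self by blast
    then show ?thesis using nonseparable_sub_cls[OF that(1,2)] e(2) that(3) by blast
  qed
  then show "edge_block T F"
    unfolding edge_block_def using nonseparable_cls[OF e(1)] cls_edges[OF e(1)] e(2) by blast
qed

lemma block_cls_iff: "block T B \<longleftrightarrow> (\<exists>e\<in>edges T. B = span T (cls e))"
  unfolding block_iff edge_block_cls_iff by blast

lemma circle_block_cls_iff:
  "circle_block T C \<longleftrightarrow> (\<exists>e\<in>edges T. h e = 1 \<and> C = span T (cls e))"
  unfolding circle_block_def block_cls_iff using circle_cls by blast

text \<open>At a vertex that is not double all edges belong to one class, and a nonseparable set
  cannot have edges on both sides of a separation.\<close>

lemma cut_vertex_double: "cut_vertex T v \<longleftrightarrow> v \<in> verts T \<and> double v"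
proof
  assume cv: "cut_vertex T v"
  then have v: "v \<in> verts T" unfolding cut_vertex_def by simp
  obtain A where A: "separation T (edges T) v A" using cv cut_vertex_T[OF linked_edges] by blast
  obtain a c where ac: "a \<in> A" "c \<in> edges T - A" "inc T a v" "inc T c v"
    by (rule separation_incident[OF linked_edges A])
  have aE: "a \<in> edges T" using ac A unfolding separation_def by auto
  have "double v"
  proof (rule ccontr)
    assume "\<not> double v"
    moreover have "v \<in> cover T (cls a)" using ac(3) by (rule cover_cls)
    ultimately have "c \<in> cls a" using side_at[OF aE, of v] ac by auto
    then show False
      using nonseparable_side[OF nonseparable_cls[OF aE] A cls_edges[OF aE]] ac cls_self[of a]
      by blast
  qed
  then show "v \<in> verts T \<and> double v" using v by simp
next
  assume "v \<in> verts T \<and> double v"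
  then show "cut_vertex T v"
    using double_separation cut_vertex_T[OF linked_edges] by metis
qed

text \<open>A class has a single end of value 2 at double vertices only, so both endpoints of such
  an edge are cut-vertices. As the edge is alone in its class, all other edges at \<open>z\<close>
  lie beyond \<open>z\<close>.\<close>

lemma bridge_separation:
  assumes "e \<in> edges T" "h e = 2" "inc T e z"
  obtains B a where "separation T (edges T) z B" "e \<notin> B" "a \<in> B" "a \<in> edges T" "inc T a z"
    "\<And>c. c \<in> edges T \<Longrightarrow> inc T c z \<Longrightarrow> c \<noteq> e \<Longrightarrow> c \<in> B"
proof -
  have c: "cls e = {e}" using h_cls_cases[OF assms(1)] assms(2) by auto
  have z: "z \<in> cover T (cls e)" using assms(3) by (rule cover_cls)
  have "double z"
    using assms(1) z
  proof (cases rule: ends_cls_cases)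
    case (two a b c' d)
    then have "a \<in> cls e" unfolding ends_def by auto
    then show ?thesis using c two(3) assms(2) by simp
  qed
  then obtain B where B: "separation T (edges T) z B" "cls e \<inter> B = {}"
      "\<forall>c\<in>edges T. inc T c z \<longrightarrow> c \<in> B \<or> c \<in> cls e"
    using side_at[OF assms(1) z] by auto
  obtain a where a: "a \<in> B" "inc T a z"
    by (rule separation_incident[OF linked_edges B(1)])
  moreover have "B \<subseteq> edges T" using B unfolding separation_def by simp
  ultimately show ?thesis using that B c by blast
qed

lemma bridge_not_loop:
  assumes "e \<in> edges T" "h e = 2"
  shows "endv T e False \<noteq> endv T e True"
proof
  assume l: "endv T e False = endv T e True"
  have c: "cls e = {e}" using h_cls_cases[OF assms(1)] assms(2) by auto
  have "ends T {e} (endv T e False) = {(e, False), (e, True)}"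
    using l unfolding ends_def by (auto; metis (full_types))
  moreover have "cover T {e} = {endv T e False}"
    using l unfolding cover_def inc_def by (auto; metis (full_types))
  ultimately have "circle (span T (cls e))"
    using linked_cls[of e] unfolding c by (simp add: circle_span)
  then show False using circle_cls[OF assms(1)] assms(2) by simp
qed

lemma circle_tree_T: "circle_tree T"
  unfolding circle_tree_def
proof (intro conjI allI impI)
  show "signed_graph T" by (rule graph)
  show "edges T \<noteq> {}" using linked_edges unfolding linked_def by simp
  show "connected_graph T" using linked_edges connected_iff_linked[OF verts_eq] by simp
next
  fix B assume "block T B"
  then obtain e where e: "e \<in> edges T" "B = span T (cls e)" unfolding block_cls_iff by blast
  then show "circle B \<or> single_edge B"
    using h_cls_cases[OF e(1)] circle_cls[OF e(1)] single_edge_span by auto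
next
  fix B assume eb: "end_block T B"
  then obtain e where e: "e \<in> edges T" "B = span T (cls e)"
    unfolding end_block_def block_cls_iff by blast
  \<comment> \<open>A bridge meets another block at each of its ends. These blocks differ: with
    respect to the separation at \<open>?x\<close>, the edge \<open>c\<close> at the far end
    \<open>?y\<close> lies on the side of the bridge, while \<open>a\<close> lies on the other
    side.\<close>
  show "circle B"
  proof (rule ccontr)
    assume "\<not> circle B"
    then have h: "h e = 2" "cls e = {e}" using h_cls_cases[OF e(1)] circle_cls[OF e(1)] e(2) by auto
    let ?x = "endv T e False" and ?y = "endv T e True"
    obtain Bx a where a: "separation T (edges T) ?x Bx" "e \<notin> Bx" "a \<in> Bx" "a \<in> edges T" "inc T a ?x"
      by (rule bridge_separation[OF e(1) h(1) inc_endv])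
    obtain By c where c: "separation T (edges T) ?y By" "e \<notin> By" "c \<in> By" "c \<in> edges T" "inc T c ?y"
      by (rule bridge_separation[OF e(1) h(1) inc_endv])
    have other: "block T (span T (cls d)) \<and> span T (cls d) \<noteq> B \<and> verts (span T (cls d)) \<inter> verts B \<noteq> {}"
      if "d \<in> edges T" "d \<noteq> e" "inc T d z" "inc T e z" for d z
    proof (intro conjI)
      show "block T (span T (cls d))" using that block_cls_iff by blast
      show "span T (cls d) \<noteq> B" using that e(2) span_inj h(2) cls_self[of d] by auto
      have "z \<in> cover T (cls d)" "z \<in> cover T (cls e)"
        using that cover_cls by blast+
      then show "verts (span T (cls d)) \<inter> verts B \<noteq> {}" using e(2) by auto
    qed
    have "span T (cls a) = span T (cls c)"
      using eb other[of a ?x] other[of c ?y] a c unfolding end_block_def by (metis inc_endv)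
    then have "c \<in> cls a" using span_inj cls_self by metis
    moreover have "cls a \<subseteq> Bx \<or> cls a \<inter> Bx = {}"
      by (rule nonseparable_side[OF nonseparable_cls[OF a(4)] a(1) cls_edges[OF a(4)]])
    ultimately have "c \<in> Bx" using a(3) cls_self[of a] by blast
    then show False
      using separationD[OF a(1) c(4) e(1) c(5) inc_endv] a(2) bridge_not_loop[OF e(1) h(1)] by auto
  qed
next
  fix v assume "cut_vertex T v"
  then have v: "v \<in> verts T" "double v" using cut_vertex_double by auto
  obtain A where A: "separation T (edges T) v A"
    "\<And>e b. e \<in> edges T \<Longrightarrow> endv T e b = v \<Longrightarrow> e \<in> A \<longleftrightarrow> s e b = 1"
    using double_separation[OF v] by blast
  obtain a c where ac: "a \<in> A" "c \<in> edges T - A" "inc T a v" "inc T c v"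
    by (rule separation_incident[OF linked_edges A(1)])
  have aE: "a \<in> edges T" using ac A(1) unfolding separation_def by auto
  have cE: "c \<in> edges T" using ac by simp
  have vc: "v \<in> cover T (cls a)" "v \<in> cover T (cls c)" using ac cover_cls by blast+
  have ne: "cls a \<noteq> cls c"
  proof
    assume "cls a = cls c"
    then have "c \<in> cls a" by simp
    then show False using cls_side[OF v A] ac by blast
  qed
  have "cls e = cls a \<or> cls e = cls c" if e: "e \<in> edges T" "v \<in> cover T (cls e)" for e
  proof -
    obtain e' where e': "e' \<in> cls e" "inc T e' v" using e(2) by (rule coverE)
    have eE': "e' \<in> edges T" using e' cls_edges[OF e(1)] by auto
    obtain b d ba where bd: "endv T e' b = v" "endv T a ba = v" "endv T c d = v"
      using e'(2) ac unfolding inc_def by auto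
    \<comment> \<open>\<open>a\<close> has a positive end at \<open>v\<close> and \<open>c\<close> a
      negative one, so \<open>e'\<close> shares a half of \<open>v\<close> with one of them.\<close>
    have "(a, e') \<in> link \<or> (c, e') \<in> link"
    proof (cases "s e' b = 1")
      case True
      then have "s a ba = s e' b" using A(2)[OF aE bd(2)] ac by simp
      then show ?thesis unfolding link_def using aE eE' bd by auto
    next
      case False
      then have "s e' b = -1" "s c d = -1"
        using sign_cases[OF eE', of b] sign_cases[OF cE, of d] A(2)[OF cE bd(3)] ac by auto
      then have "endv T c d = endv T e' b \<and> s c d = s e' b" using bd by simp
      then show ?thesis unfolding link_def using cE eE' by blast
    qed
    then have "e' \<in> cls a \<or> e' \<in> cls c" using cls_link[OF cls_self] by blast
    then show ?thesis using cls_eq[OF e'(1)] cls_eq by metis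
  qed
  then have "block T B \<and> v \<in> verts B \<longleftrightarrow> B = span T (cls a) \<or> B = span T (cls c)" for B
    using vc aE cE unfolding block_cls_iff by (metis span_simps(1))
  then have "{B. block T B \<and> v \<in> verts B} = {span T (cls a), span T (cls c)}" by auto
  then show "card {B. block T B \<and> v \<in> verts B} = 2" using ne by (simp add: span_inj)
qed

text \<open>The sign of an edge is minus the product of the signs of its two ends. Regrouped by
  vertices, the ends give 1 at a cut-vertex and -1 at any other vertex; the minus signs of the edges
  give one factor -1 per vertex, as a circle has as many edges as vertices.\<close>

lemma circle_sign_cls:
  assumes e: "e \<in> edges T" "h e = 1"
  shows "circle_sign (span T (cls e)) = (-1) ^ card {v \<in> cover T (cls e). cut_vertex T v}"
proof -
  let ?F = "cls e" and ?V = "cover T (cls e)"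
  have FE: "?F \<subseteq> edges T" by (rule cls_edges[OF e(1)])
  have finF: "finite ?F" using FE by (rule finite_sub)
  have finV: "finite ?V" using finF by (rule finite_cover)
  have VT: "?V \<subseteq> verts T" using FE verts_eq unfolding cover_def by auto
  have deg: "card (ends T ?F v) = 2" if "v \<in> ?V" for v by (rule card_ends_cls[OF e that])
  have "(\<Sum>v\<in>?V. \<Sum>(e, b)\<in>ends T ?F v. (1::nat)) = (\<Sum>e\<in>?F. 1 + 1)"
    by (rule sum_ends[OF finF finV]) simp
  then have "card ?V * 2 = card ?F * 2" using deg by simp
  then have cards: "card ?F = card ?V" by simp
  have at_v: "(\<Prod>(e, b)\<in>ends T ?F v. s e b) = (if cut_vertex T v then 1 else -1)" if v: "v \<in> ?V" for v
    using e(1) v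
  proof (cases rule: ends_cls_cases)
    case (two a b c d)
    then have "a \<in> ?F" unfolding ends_def by auto
    then have "s a b = 1 \<or> s a b = -1" using sign_cases FE by blast
    moreover have "(\<Prod>(e, b)\<in>ends T ?F v. s e b) = s a b * s c d" using two by simp
    moreover have "cut_vertex T v \<longleftrightarrow> double v" using cut_vertex_double v VT by blast
    ultimately show ?thesis using two(5) by auto
  next
    case (one a b)
    then show ?thesis using deg[OF v] by simp
  qed
  have "circle_sign (span T ?F) = (\<Prod>e\<in>?F. (-1) * (s e False * s e True))"
    unfolding circle_sign_def using orient FE
    by (intro prod.cong) (auto simp: orientation_def)
  also have "\<dots> = (-1) ^ card ?F * (\<Prod>v\<in>?V. \<Prod>(e, b)\<in>ends T ?F v. s e b)"
    unfolding prod.distrib prod_ends[OF finF finV subset_refl] by simp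
  also have "(\<Prod>v\<in>?V. \<Prod>(e, b)\<in>ends T ?F v. s e b) = (\<Prod>v\<in>?V. if cut_vertex T v then 1 else -1)"
    using at_v by (rule prod.cong[OF refl])
  also have "\<dots> = (-1) ^ card {v \<in> ?V. \<not> cut_vertex T v}"
    using finV by (simp add: prod.If_cases Int_def)
  also have "card ?F = card {v \<in> ?V. cut_vertex T v} + card {v \<in> ?V. \<not> cut_vertex T v}"
    unfolding cards using finV by (subst card_Un_disjoint[symmetric]) (auto intro!: arg_cong[of _ _ card])
  finally show ?thesis by (simp add: power_add flip: power_mult_distrib mult.assoc)
qed

text \<open>Both halves of every vertex have positive weight, which excludes sinks and sources. On a
  class, a cut-vertex shows a single half, so all ends there have the same sign.\<close>

lemma direction_T: "direction T s"
  unfolding direction_def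
proof (intro conjI allI impI)
  show "orientation T s" by (rule orient)
next
  fix v
  have ex: "\<exists>e b. (e, b) \<in> ends_at T v \<and> s e b = \<sigma>" if "v \<in> verts T" "\<sigma> = 1 \<or> \<sigma> = -1" for \<sigma>
  proof -
    have "half v \<sigma> \<noteq> {}"
      using weight_double[OF that] unfolding weight_def half_def[symmetric] by (auto split: if_splits)
    then show ?thesis unfolding half_def ends_at_ends by auto
  qed
  show "\<not> sink T s v" using ex[of "-1"] unfolding sink_def by fastforce
  show "\<not> source T s v" using ex[of 1] unfolding source_def by fastforce
next
  fix C v assume C: "circle_block T C" "v \<in> verts C" "cut_vertex T v"
  then obtain e where e: "e \<in> edges T" "C = span T (cls e)" unfolding circle_block_cls_iff by blast
  have v: "v \<in> cover T (cls e)" using C(2) e(2) by simp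
  have dv: "double v" using C(3) cut_vertex_double by simp
  from e(1) v show "sink C s v \<or> source C s v"
  proof (cases rule: ends_cls_cases)
    case (two a b c d)
    then have "a \<in> cls e" unfolding ends_def by auto
    then have "s a b = 1 \<or> s a b = -1" using sign_cases cls_edges[OF e(1)] by blast
    then show ?thesis using two dv v unfolding sink_def source_def e(2) by auto
  next
    case (one a b)
    then have "a \<in> cls e" unfolding ends_def by auto
    then have "s a b = 1 \<or> s a b = -1" using sign_cases cls_edges[OF e(1)] by blast
    then show ?thesis using one v unfolding sink_def source_def e(2) by auto
  qed
qed

end

section \<open>Block paths\<close>

lemma path_rev:
  assumes "path T vs es"
  shows "path T (rev vs) (rev es)"
  unfolding path_def
proof (intro conjI allI impI)
  have l: "length vs = Suc (length es)" using assms unfolding path_def by simp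
  show "length (rev vs) = Suc (length (rev es))" using l by simp
  fix i assume i: "i < length (rev es)"
  let ?j = "length es - Suc i"
  have "range (endv T (es ! ?j)) = {vs ! ?j, vs ! Suc ?j}"
    using assms i unfolding path_def by simp
  moreover have "rev es ! i = es ! ?j" using i by (simp add: rev_nth)
  moreover have "rev vs ! i = vs ! Suc ?j"
    using i l by (simp add: rev_nth Suc_diff_Suc)
  moreover have "rev vs ! Suc i = vs ! ?j" using i l by (simp add: rev_nth)
  ultimately show "range (endv T (rev es ! i)) = {rev vs ! i, rev vs ! Suc i}" by auto
qed (use assms in \<open>auto simp: path_def\<close>)

lemma path_inc:
  assumes "path T vs es" "i < length es"
  shows "inc T (es ! i) (vs ! i)" "inc T (es ! i) (vs ! Suc i)"
proof -
  have "range (endv T (es ! i)) = {vs ! i, vs ! Suc i}" using assms unfolding path_def by simp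
  then show "inc T (es ! i) (vs ! i)" "inc T (es ! i) (vs ! Suc i)"
    unfolding inc_def by (metis insertI1 insertI2 rangeE)+
qed

text \<open>Going backwards from the last edge, consecutive edges meet in a vertex other than the
  last one, so they stay on the same side.\<close>

lemma path_avoids_separation:
  assumes p: "path T vs es" and B: "separation T (edges T) (last vs) B" and last: "last es \<notin> B"
    and i: "i < length es"
  shows "es ! i \<notin> B"
proof -
  have l: "length vs = Suc (length es)" and d: "distinct vs" and E: "set es \<subseteq> edges T"
    using p unfolding path_def by auto
  have lv: "last vs = vs ! length es" using l by (metis diff_Suc_1 last_conv_nth list.size(3) nat.distinct(1))
  have "i \<le> length es - 1" using i by simp
  then show ?thesis
  proof (induction rule: inc_induct)
    case base
    then show ?case using last i by (metis last_conv_nth list.size(3) not_less_zero)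
  next
    case (step k)
    then have k: "Suc k < length es" by simp
    then have "vs ! Suc k \<noteq> last vs"
      unfolding lv using d l by (simp add: nth_eq_iff_index_eq)
    moreover have "es ! k \<in> edges T" "es ! Suc k \<in> edges T" using E k by auto
    ultimately show ?case
      using separationD[OF B, of "es ! k" "es ! Suc k" "vs ! Suc k"] step.IH
        path_inc(2)[OF p, of k] path_inc(1)[OF p, of "Suc k"] k by simp
  qed
qed

lemma path_vertex_inc:
  assumes "path T vs es" "es \<noteq> []" "z \<in> set vs"
  obtains i where "i < length es" "inc T (es ! i) z"
proof -
  obtain j where j: "j < length vs" "vs ! j = z" using assms(3) by (auto simp: in_set_conv_nth)
  have l: "length vs = Suc (length es)" using assms unfolding path_def by simp
  show ?thesis
  proof (cases "j < length es")
    case True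
    then show ?thesis using that[of j] path_inc(1)[OF assms(1) True] j by simp
  next
    case False
    then obtain k where k: "j = Suc k" "k < length es" using j l assms(2) by (cases j) auto
    then show ?thesis using that[of k] path_inc(2)[OF assms(1) k(2)] j by simp
  qed
qed

section \<open>Longest paths of bridges\<close>

context minimal_flow_graph
begin

definition bridge_path :: "'v list \<Rightarrow> 'e list \<Rightarrow> bool" where
  "bridge_path vs es \<longleftrightarrow> path T vs es \<and> (\<forall>e\<in>set es. h e = 2)"

text \<open>The last vertex is a cut-vertex with the path on one side and a further edge on the
  other. Hence the far end of that edge is a new vertex of the path.\<close>

lemma bridge_path_extends:
  assumes bp: "bridge_path vs es" and ne: "es \<noteq> []"
    and stop: "\<And>a. a \<in> edges T \<Longrightarrow> inc T a (last vs) \<Longrightarrow> h a \<noteq> 1"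
  shows "\<exists>z a. bridge_path (vs @ [z]) (es @ [a])"
proof -
  have p: "path T vs es" and h2: "\<forall>e\<in>set es. h e = 2" using bp unfolding bridge_path_def by auto
  have l: "length vs = Suc (length es)" and d: "distinct vs" and E: "set es \<subseteq> edges T"
    and rg: "\<forall>i<length es. range (endv T (es ! i)) = {vs ! i, vs ! Suc i}"
    using p unfolding path_def by auto
  let ?z = "last vs" and ?e = "last es"
  have eE: "?e \<in> edges T" "h ?e = 2" using ne E h2 by auto
  have lv: "?z = vs ! length es" using l by (metis diff_Suc_1 last_conv_nth list.size(3) nat.distinct(1))
  have "?e = es ! (length es - 1)" using ne by (simp add: last_conv_nth)
  then have inc: "inc T ?e ?z"
    using path_inc(2)[OF p, of "length es - 1"] ne lv by simp
  obtain B a where B: "separation T (edges T) ?z B" "?e \<notin> B" "a \<in> B" "a \<in> edges T" "inc T a ?z"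
    by (rule bridge_separation[OF eE inc])
  have ha: "h a = 2" using h_cls_cases[OF B(4)] stop[OF B(4,5)] by auto
  obtain b where b: "endv T a b = ?z" using B(5) unfolding inc_def by auto
  let ?y = "endv T a (\<not> b)"
  have yz: "?y \<noteq> ?z" using b bridge_not_loop[OF B(4) ha] by (cases b) auto
  have "?y \<notin> set vs"
  proof
    assume "?y \<in> set vs"
    then obtain i where i: "i < length es" "inc T (es ! i) ?y" by (rule path_vertex_inc[OF p ne])
    then have "es ! i \<in> edges T" using E by auto
    then have "a \<in> B \<longleftrightarrow> es ! i \<in> B"
      using separationD[OF B(1) B(4) _ inc_endv i(2) yz] by simp
    then show False using path_avoids_separation[OF p B(1,2) i(1)] B(3) by simp
  qed
  moreover have "range (endv T a) = {?z, ?y}"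
    using b by (cases b) (auto simp: UNIV_bool)
  moreover have "?y \<in> verts T" using endv_verts[OF B(4)] by simp
  ultimately have "path T (vs @ [?y]) (es @ [a])"
    unfolding path_def using p l d E B(4) lv rg
    by (auto simp: path_def nth_append less_Suc_eq)
  then have "bridge_path (vs @ [?y]) (es @ [a])" using h2 ha unfolding bridge_path_def by simp
  then show ?thesis by blast
qed

text \<open>A longest path of bridges through \<open>e\<close> can stop only at circles. Its length
  is bounded because its vertices are distinct.\<close>

lemma bridge_on_block_path:
  assumes e: "e \<in> edges T" "h e = 2"
  shows "\<exists>vs es. block_path T vs es \<and> e \<in> set es"
proof -
  define Q where "Q vs es \<longleftrightarrow> bridge_path vs es \<and> e \<in> set es" for vs es
  have "path T [endv T e False, endv T e True] [e]"
    using e(1) bridge_not_loop[OF e] endv_verts[OF e(1)]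
    unfolding path_def by (auto simp: UNIV_bool)
  then have "Q [endv T e False, endv T e True] [e]"
    using e(2) unfolding Q_def bridge_path_def by simp
  then have ex: "\<exists>vs es. Q vs es \<and> length es = 1" by (intro exI conjI) auto
  have bound: "length es \<le> card (verts T)" if "Q vs es" for vs es
  proof -
    have "distinct vs" "set vs \<subseteq> verts T" "length vs = Suc (length es)"
      using that unfolding Q_def bridge_path_def path_def by auto
    then show ?thesis using card_mono[OF fin_verts, of "set vs"] distinct_card[of vs] by simp
  qed
  define n where "n = (GREATEST n. \<exists>vs es. Q vs es \<and> length es = n)"
  let ?P = "\<lambda>n. \<exists>vs es. Q vs es \<and> length es = n"
  have bd: "\<forall>k. ?P k \<longrightarrow> k \<le> card (verts T)" using bound by blast
  have "?P n" unfolding n_def by (rule GreatestI_nat[where P = ?P, OF ex]) (use bd in blast)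
  then obtain vs es where Q: "Q vs es" "length es = n" by blast
  have max: "length es' \<le> n" if "Q vs' es'" for vs' es'
    unfolding n_def by (rule Greatest_le_nat[where P = ?P]) (use that bd in blast)+
  have circle_end: "\<exists>a\<in>edges T. inc T a (last vs') \<and> h a = 1"
    if Q': "Q vs' es'" "length es' = n" for vs' es'
  proof (rule ccontr)
    assume "\<not> ?thesis"
    then have "\<exists>z a. bridge_path (vs' @ [z]) (es' @ [a])"
      using Q' bridge_path_extends[of vs' es'] unfolding Q_def by (metis empty_iff empty_set)
    then obtain z a where "Q (vs' @ [z]) (es' @ [a])" using Q' unfolding Q_def by auto
    then show False using max[of "vs' @ [z]" "es' @ [a]"] Q'(2) by simp
  qed
  have p: "path T vs es" and h2: "\<forall>e\<in>set es. h e = 2" and "e \<in> set es"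
    using Q(1) unfolding Q_def bridge_path_def by auto
  have l: "length vs = Suc (length es)" and E: "set es \<subseteq> edges T" and d: "distinct vs"
    using p unfolding path_def by auto
  have ne: "es \<noteq> []" using \<open>e \<in> set es\<close> by auto
  \<comment> \<open>Paths are extended at their last vertex; reversal gives the same conclusion for
    the first one.\<close>
  have "Q (rev vs) (rev es)"
    using Q(1) path_rev[OF p] unfolding Q_def bridge_path_def by simp
  then obtain a where "a \<in> edges T" "inc T a (last (rev vs))" "h a = 1"
    using circle_end[of "rev vs" "rev es"] Q(2) by auto
  then have a: "a \<in> edges T" "inc T a (hd vs)" "h a = 1" by (simp_all add: last_rev)
  obtain c where c: "c \<in> edges T" "inc T c (last vs)" "h c = 1" using circle_end[OF Q] by blast
  have lv: "last vs = vs ! length es" using l by (metis diff_Suc_1 last_conv_nth list.size(3) nat.distinct(1))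
  have hv: "hd vs = vs ! 0" using l by (cases vs) auto
  \<comment> \<open>In the separation at the last vertex, the path and with it \<open>a\<close> are
    on one side and \<open>c\<close> is on the other, so the two ends lie on different
    circles.\<close>
  have "cls a \<noteq> cls c"
  proof
    assume eq: "cls a = cls c"
    have le: "last es \<in> edges T" "h (last es) = 2" using ne E h2 by auto
    have inc: "inc T (last es) (last vs)"
      using path_inc(2)[OF p, of "length es - 1"] ne lv by (simp add: last_conv_nth)
    obtain B x where B: "separation T (edges T) (last vs) B" "last es \<notin> B" "x \<in> B"
        "x \<in> edges T" "inc T x (last vs)"
        "\<And>c. c \<in> edges T \<Longrightarrow> inc T c (last vs) \<Longrightarrow> c \<noteq> last es \<Longrightarrow> c \<in> B"
      using bridge_separation[OF le inc] by blast
    have "c \<in> B" using B(6) c le(2) by fastforce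
    have hd_last: "hd vs \<noteq> last vs"
      unfolding hv lv using d l ne by (simp add: nth_eq_iff_index_eq)
    have e0: "es ! 0 \<in> edges T" "es ! 0 \<notin> B" "inc T (es ! 0) (hd vs)"
      using ne E path_avoids_separation[OF p B(1,2), of 0] path_inc(1)[OF p, of 0] hv by auto
    have "a \<notin> B" using separationD[OF B(1) a(1) e0(1) a(2) e0(3) hd_last] e0(2) by simp
    moreover have "cls a \<subseteq> B \<or> cls a \<inter> B = {}"
      by (rule nonseparable_side[OF nonseparable_cls[OF a(1)] B(1) cls_edges[OF a(1)]])
    ultimately show False using \<open>c \<in> B\<close> cls_self[of a] cls_self[of c] eq by blast
  qed
  then have "span T (cls a) \<noteq> span T (cls c)" by (simp add: span_inj)
  moreover have "circle_block T (span T (cls a))" "circle_block T (span T (cls c))"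
    using a c circle_block_cls_iff by blast+
  moreover have "hd vs \<in> verts (span T (cls a))" "last vs \<in> verts (span T (cls c))"
    using a c cover_cls by simp_all
  moreover have "\<exists>B. block T B \<and> \<not> circle B \<and> g \<in> edges B" if "g \<in> set es" for g
  proof -
    have "g \<in> edges T" "h g = 2" using that E h2 by auto
    then show ?thesis using block_cls_iff circle_cls[of g] by (intro exI[of _ "span T (cls g)"]) auto
  qed
  ultimately have "block_path T vs es" using p unfolding block_path_def by blast
  then show ?thesis using \<open>e \<in> set es\<close> by blast
qed

lemma tree_indicator_eq:
  assumes "e \<in> edges T"
  shows "tree_indicator T e = h e"
proof -
  have blk: "edge_block T (cls e)" using assms edge_block_cls_iff by blast
  consider "h e = 1" | "h e = 2" using h_cls_cases[OF assms] by auto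
  then show ?thesis
  proof cases
    case 1
    then show ?thesis using indicator_circle[OF blk _ cls_self] circle_cls[OF assms] by simp
  next
    case 2
    have "tree_indicator T e \<noteq> 0"
      using bridge_on_block_path[OF assms 2] unfolding tree_indicator_def by simp
    then show ?thesis using 2 indicator_noncircle[OF blk _ cls_self] circle_cls[OF assms] by simp
  qed
qed

lemma sesqui_eulerian_T: "sesqui_eulerian_circle_tree T"
  unfolding sesqui_eulerian_circle_tree_def circle_block_cls_iff
  using circle_tree_T circle_sign_cls by auto

end

theorem theorem4p6:
  fixes G :: "('v, 'e) sgraph" and \<omega> :: "'e \<Rightarrow> bool \<Rightarrow> int" and f :: "'e \<Rightarrow> int"
  assumes "signed_graph G" and "orientation G \<omega>" and "integral_flow G \<omega> f"
  shows "conformally_indecomposable G \<omega> f \<longleftrightarrow>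
    sesqui_eulerian_circle_tree (support G f) \<and>
    (\<exists>\<omega>\<^sub>f. direction (support G f) \<omega>\<^sub>f \<and>
      (\<forall>e\<in>edges G. f e = coupling G \<omega> (support G f) \<omega>\<^sub>f e * tree_indicator (support G f) e))"
    (is "?L \<longleftrightarrow> ?R")
proof -
  interpret flow_support G \<omega> f by unfold_locales (fact assms)+
  show ?thesis
  proof
    assume ?L
    then interpret minimal_flow_graph S sigma "\<lambda>e. \<bar>f e\<bar>"
      by unfold_locales (use orientation_sigma indecomposable_iff in auto)
    \<comment> \<open>The coupling of \<open>\<omega>\<close> with \<open>sigma\<close> is the sign
      of \<open>f\<close> on the support. Elsewhere it is 0 by definition, which agrees with
      \<open>f\<close>.\<close>
    have "f e = coupling G \<omega> S sigma e * tree_indicator S e" if e: "e \<in> edges G" for e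
    proof (cases "f e = 0")
      case False
      then have "coupling G \<omega> S sigma e = sgn (f e)"
      proof -
        have "\<omega> e False = 1 \<or> \<omega> e False = -1" using assms(2) e unfolding orientation_def by auto
        then show ?thesis using e False by (auto simp: coupling_def sigma_def)
      qed
      moreover have "tree_indicator S e = \<bar>f e\<bar>" using tree_indicator_eq[of e] e False by simp
      ultimately show ?thesis by (simp add: sgn_mult_abs)
    qed (simp add: coupling_def)
    then show ?R using sesqui_eulerian_T direction_T by blast
  next
    assume ?R
    then show ?L using circle_tree_indecomposable unfolding sesqui_eulerian_circle_tree_def by blast
  qed
qed

end
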